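(* Let $R$ be a commutative ring with identity having finitely many minimal primes. Then: (1) $\mathrm{diam}(\mathbb{AG}(R))=0$ if and only if $Z(R)$ is the only nonzero proper ideal of $R$. (2) $\mathrm{diam}(\mathbb{AG}(R))=1$ if and only if $R=F_1\oplus F_2$ where $F_1,F_2$ are fields, or $Z(R)$ is an ideal of $R$ with $Z(R)^2=(0)$, or $R$ is a local ring with exactly two nonzero proper ideals $Z(R)$ and $Z(R)^2$. (3) $\mathrm{diam}(\mathbb{AG}(R))=2$ if and only if either $R$ is reduced with exactly two minimal primes and at least three nonzero annihilating-ideals, or $R$ is not reduced, $Z(R)$ is an ideal whose square is not $(0)$ and for each pair of annihilating-ideals $I$ and $J$, $I+J$ is an annihilating-ideal. (4) $\mathrm{diam}(\mathbb{AG}(R))=3$ if and only if either $R$ is reduced with more than two minimal primes, or $R$ is non-reduced and there are annihilating-ideals $I\neq J$ such that $I+J$ is not an annihilating-ideal.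
   Context: $Z(R)$ denotes the set of all zero divisors of $R$ (including $0$). An ideal $I$ of $R$ is an annihilating-ideal if $\mathrm{Ann}(I)\neq(0)$, i.e. there is a nonzero ideal $J$ of $R$ with $IJ=(0)$. The annihilating-ideal graph $\mathbb{AG}(R)$ is the undirected simple graph whose vertices are the nonzero annihilating-ideals of $R$, where two distinct vertices $I,J$ are adjacent if and only if $IJ=(0)$. For a graph $G$, $d(x,y)$ is the length of a shortest path from $x$ to $y$ ($\infty$ if there is none) and $\mathrm{diam}(G)=\sup\{d(x,y): x,y \text{ distinct vertices of } G\}$; $\mathrm{diam}(G)=0$ means that $G$ has exactly one vertex, and diameters are considered only for graphs with at least one vertex (so $\mathbb{AG}(R)$ is assumed nonempty, i.e. $R$ is not an integral domain).
   Formalization: In (2), the case "Z(R) is an ideal with Z(R)^2=(0)" also requires at least two nonzero annihilating-ideals (Z/4 has diameter 0); in (3), the non-reduced case also requires at least three nonzero annihilating-ideals (Z/8 has diameter 1). *)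

theory Defs
  imports
    "HOL-Algebra.Algebra"
    "HOL-Library.Extended_Nat"
    "Graph_Theory.Arc_Walk"
begin

text \<open>For a ring with \<open>\<one> \<noteq> \<zero>\<close> this set contains \<open>\<zero>\<close>.\<close>

definition zero_divisors :: "('a, 'b) ring_scheme \<Rightarrow> 'a set" where
  "zero_divisors R =
     {x \<in> carrier R. \<exists>y \<in> carrier R. y \<noteq> \<zero>\<^bsub>R\<^esub> \<and> x \<otimes>\<^bsub>R\<^esub> y = \<zero>\<^bsub>R\<^esub>}"

definition ann :: "('a, 'b) ring_scheme \<Rightarrow> 'a set \<Rightarrow> 'a set" where
  "ann R I = {r \<in> carrier R. \<forall>x \<in> I. r \<otimes>\<^bsub>R\<^esub> x = \<zero>\<^bsub>R\<^esub>}"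

definition annihilating_ideal :: "('a, 'b) ring_scheme \<Rightarrow> 'a set \<Rightarrow> bool" where
  "annihilating_ideal R I \<longleftrightarrow> ideal I R \<and> ann R I \<noteq> {\<zero>\<^bsub>R\<^esub>}"

definition nonzero_annihilating_ideals :: "('a, 'b) ring_scheme \<Rightarrow> 'a set set" where
  "nonzero_annihilating_ideals R = {I. annihilating_ideal R I \<and> I \<noteq> {\<zero>\<^bsub>R\<^esub>}}"

definition nonzero_proper_ideals :: "('a, 'b) ring_scheme \<Rightarrow> 'a set set" where
  "nonzero_proper_ideals R = {I. ideal I R \<and> I \<noteq> {\<zero>\<^bsub>R\<^esub>} \<and> I \<noteq> carrier R}"

definition minimal_primes :: "('a, 'b) ring_scheme \<Rightarrow> 'a set set" where
  "minimal_primes R = {P. primeideal P R \<and> (\<forall>Q. primeideal Q R \<and> Q \<subseteq> P \<longrightarrow> Q = P)}"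

definition reduced_ring :: "('a, 'b) ring_scheme \<Rightarrow> bool" where
  "reduced_ring R \<longleftrightarrow>
     (\<forall>x \<in> carrier R. \<forall>n::nat. x [^]\<^bsub>R\<^esub> n = \<zero>\<^bsub>R\<^esub> \<longrightarrow> x = \<zero>\<^bsub>R\<^esub>)"

definition local_ring :: "('a, 'b) ring_scheme \<Rightarrow> bool" where
  "local_ring R \<longleftrightarrow> (\<exists>!M. maximalideal M R)"

text \<open>An undirected simple graph is represented as a symmetric digraph without loops or
  parallel arcs: each edge is a pair of opposite arcs.\<close>

definition annihilating_ideal_graph ::
  "('a, 'b) ring_scheme \<Rightarrow> ('a set, 'a set \<times> 'a set) pre_digraph" where
  "annihilating_ideal_graph R =
     \<lparr> verts = nonzero_annihilating_ideals R,
       arcs = {(I, J). I \<in> nonzero_annihilating_ideals R \<and> J \<in> nonzero_annihilating_ideals R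
                 \<and> I \<noteq> J \<and> I \<cdot>\<^bsub>R\<^esub> J = {\<zero>\<^bsub>R\<^esub>}},
       tail = fst, head = snd \<rparr>"

text \<open>A path is the list of its arcs, so its length is the number of edges. The infimum of the
  empty set is \<open>\<infinity>\<close>, and the supremum of the empty set is \<open>0\<close>.\<close>

definition graph_dist :: "('v, 'e) pre_digraph \<Rightarrow> 'v \<Rightarrow> 'v \<Rightarrow> enat" where
  "graph_dist G u v = (INF p \<in> {p. pre_digraph.apath G u p v}. enat (length p))"

definition graph_diam :: "('v, 'e) pre_digraph \<Rightarrow> enat" where
  "graph_diam G =
     (SUP (u, v) \<in> {(u, v). u \<in> verts G \<and> v \<in> verts G \<and> u \<noteq> v}. graph_dist G u v)"

lemma (in cring) ann_is_ideal:
  assumes "ideal I R"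
  shows "ideal (ann R I) R"
proof (rule idealI)
  have carr: "x \<in> carrier R" if "x \<in> I" for x
    using ideal.Icarr[OF assms that] .
  show "ring R" by (rule ring_axioms)
  show "subgroup (ann R I) (add_monoid R)"
  proof (rule add.subgroupI)
    show "ann R I \<noteq> {}"
      using carr by (auto simp: ann_def intro!: exI[of _ \<zero>])
  qed (auto simp: ann_def carr l_distr l_minus)
  show "x \<otimes> a \<in> ann R I" if "a \<in> ann R I" "x \<in> carrier R" for a x
    using that by (auto simp: ann_def carr m_assoc)
  then show "a \<otimes> x \<in> ann R I" if "a \<in> ann R I" "x \<in> carrier R" for a x
    using that by (metis (no_types, lifting) ann_def m_comm mem_Collect_eq)
qed

lemma (in cring) annihilating_ideal_iff:
  "annihilating_ideal R I \<longleftrightarrow>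
     ideal I R \<and> (\<exists>J. ideal J R \<and> J \<noteq> {\<zero>} \<and> I \<cdot> J = {\<zero>})"
proof (cases "ideal I R")
  case True
  have carr: "x \<in> carrier R" if "x \<in> I" for x
    using ideal.Icarr[OF True that] .
  have zI: "\<zero> \<in> I"
    using True by (simp add: additive_subgroup.zero_closed ideal.axioms(1))
  have prod_ann: "I \<cdot> ann R I = {\<zero>}"
  proof (intro equalityI subsetI)
    fix s assume "s \<in> I \<cdot> ann R I"
    then show "s \<in> {\<zero>}"
      by (induct rule: ideal_prod.induct) (use carr in \<open>auto simp: ann_def m_comm\<close>)
  next
    fix s assume "s \<in> {\<zero>}"
    then show "s \<in> I \<cdot> ann R I"
      using ideal_prod.prod[of \<zero> I \<zero> "ann R I" R] zI
      by (auto simp: ann_def carr)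
  qed
  have "ann R I \<noteq> {\<zero>}" if J: "ideal J R" "J \<noteq> {\<zero>}" "I \<cdot> J = {\<zero>}" for J
  proof -
    have "j \<in> ann R I" if "j \<in> J" for j
      using ideal_prod.prod[OF _ that, of _ I R] J(3) ideal.Icarr[OF J(1) that] carr
      by (auto simp: ann_def m_comm)
    moreover have "\<zero> \<in> J"
      using J(1) by (simp add: additive_subgroup.zero_closed ideal.axioms(1))
    ultimately show ?thesis using J(2) by auto
  qed
  then show ?thesis
    using True prod_ann ann_is_ideal[OF True] unfolding annihilating_ideal_def by blast
qed (simp add: annihilating_ideal_def)

lemma (in cring) annihilating_ideal_graph_simple:
  "sym_digraph (annihilating_ideal_graph R)"
  "loopfree_digraph (annihilating_ideal_graph R)"
  "nomulti_digraph (annihilating_ideal_graph R)"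
proof -
  let ?G = "annihilating_ideal_graph R"
  have wf: "wf_digraph ?G"
    by unfold_locales (auto simp: annihilating_ideal_graph_def)
  have "I \<cdot> J = J \<cdot> I"
    if "I \<in> nonzero_annihilating_ideals R" "J \<in> nonzero_annihilating_ideals R" for I J
    using that ideal_prod_commute
    by (auto simp: nonzero_annihilating_ideals_def annihilating_ideal_def)
  then have "symmetric ?G"
    by (auto simp: symmetric_def sym_def arcs_ends_conv annihilating_ideal_graph_def
        image_iff)
  with wf show "sym_digraph ?G"
    by (simp add: sym_digraph_def sym_digraph_axioms_def)
  show "loopfree_digraph ?G"
    using wf by (auto simp: loopfree_digraph_def loopfree_digraph_axioms_def
        annihilating_ideal_graph_def)
  show "nomulti_digraph ?G"
    using wf by (auto simp: nomulti_digraph_def nomulti_digraph_axioms_def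
        arc_to_ends_def annihilating_ideal_graph_def)
qed

end

theory Submission
  imports Defs
begin

text \<open>
  Fix two distinct vertices \<open>I\<close> and \<open>J\<close>. A common neighbour of two nonadjacent vertices exists
  precisely when some nonzero element annihilates \<open>I\<close> and \<open>J\<close>, that is, when \<open>I + J\<close> is
  annihilating (\<open>dist_le_2_iff\<close>). Failing that, \<open>Ann(I)\<close> and \<open>Ann(J)\<close> meet in zero, so
  \<open>I, Ann(I), Ann(J), J\<close> is a path. Hence the diameter is at most three (\<open>diam_le_3\<close>), and each
  of its values becomes an algebraic condition: diameter at most one says that distinct vertices
  have product zero, and diameter at most two says that distinct vertices have product zero or
  an annihilating sum.

  Diameter zero and one are governed by multiplication inside principal ideals. If distinct
  vertices annihilate each other, a zero divisor \<open>x\<close> with \<open>x\<^sup>2\<close> generating the ideal of \<open>x\<close> yields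
  an idempotent that splits the ring into two fields. Otherwise \<open>x\<^sup>3 = \<zero>\<close> for all zero divisors,
  and \<open>Z(R)\<close> is an ideal. Its square is zero, or \<open>Z(R)\<close> is generated by one element \<open>x\<close> with
  \<open>x\<^sup>2 \<noteq> \<zero>\<close> and the ring has exactly the nonzero proper ideals \<open>Z(R)\<close> and \<open>Z(R)\<^sup>2\<close>
  (\<open>complete_iff\<close>).

  To separate diameter two from three, suppose first that the ring is reduced. Its minimal primes
  intersect in zero, so a nonzero annihilator of an ideal avoids some minimal prime, which then
  contains the ideal. With exactly two minimal primes this places every vertex inside one of
  them, and distances are at most two. With finitely many but at least three, two minimal primes
  are vertices at distance three. If the ring is not reduced, a nonzero element with square zero turns
  any pair of annihilating ideals whose sum is not annihilating into a pair of vertices at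
  distance three (\<open>nonreduced_sum_not_annihilating\<close>).
\<close>

section \<open>Distances in digraphs\<close>

context wf_digraph
begin

text \<open>The infimum is attained because \<open>enat\<close> is well ordered; the empty set of paths gives
  \<open>\<infinity>\<close>, which lies below no natural number.\<close>

lemma graph_dist_le_iff:
  "graph_dist G u v \<le> enat k \<longleftrightarrow> (\<exists>p. apath u p v \<and> length p \<le> k)"
proof
  assume le: "graph_dist G u v \<le> enat k"
  let ?L = "(\<lambda>p. enat (length p)) ` {p. apath u p v}"
  have "?L \<noteq> {}"
  proof
    assume "?L = {}"
    then have "graph_dist G u v = \<infinity>"
      unfolding graph_dist_def by (simp add: top_enat_def)
    then show False using le by simp
  qed
  then have "Inf ?L \<in> ?L"
    by (auto simp: Inf_enat_def intro: LeastI)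
  then show "\<exists>p. apath u p v \<and> length p \<le> k"
    using le by (auto simp: graph_dist_def)
next
  assume "\<exists>p. apath u p v \<and> length p \<le> k"
  then show "graph_dist G u v \<le> enat k"
    unfolding graph_dist_def by (auto intro: INF_lower2)
qed

lemma dominatesE_arc:
  assumes "u \<rightarrow>\<^bsub>G\<^esub> v"
  obtains e where "e \<in> arcs G" "tail G e = u" "head G e = v" "u \<in> verts G" "v \<in> verts G"
  using assms by (auto simp: arcs_ends_conv)

lemma graph_dist_le_1_iff:
  assumes "u \<noteq> v"
  shows "graph_dist G u v \<le> 1 \<longleftrightarrow> u \<rightarrow>\<^bsub>G\<^esub> v"
proof -
  have "(\<exists>p. apath u p v \<and> length p \<le> 1) \<longleftrightarrow> u \<rightarrow>\<^bsub>G\<^esub> v"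
  proof
    assume "\<exists>p. apath u p v \<and> length p \<le> 1"
    then obtain p where p: "apath u p v" "length p \<le> 1" by blast
    then obtain e where "p = [e]"
      using assms by (cases p) (auto simp: apath_simps)
    then show "u \<rightarrow>\<^bsub>G\<^esub> v"
      using p in_arcs_imp_in_arcs_ends[of e] by (auto simp: apath_simps)
  next
    assume "u \<rightarrow>\<^bsub>G\<^esub> v"
    then obtain e where "e \<in> arcs G" "tail G e = u" "head G e = v" "v \<in> verts G"
      by (rule dominatesE_arc)
    then have "apath u [e] v"
      using assms by (auto simp: apath_simps)
    then show "\<exists>p. apath u p v \<and> length p \<le> 1"
      by (intro exI[of _ "[e]"]) auto
  qed
  then show ?thesis
    using graph_dist_le_iff[of u v 1] by (simp add: one_enat_def)
qed

lemma graph_dist_le_2_iff: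
  assumes "u \<noteq> v"
  shows "graph_dist G u v \<le> 2 \<longleftrightarrow> u \<rightarrow>\<^bsub>G\<^esub> v \<or> (\<exists>w. u \<rightarrow>\<^bsub>G\<^esub> w \<and> w \<rightarrow>\<^bsub>G\<^esub> v)"
proof -
  have two: "(2::enat) = enat 2" by (simp add: numeral_eq_enat)
  show ?thesis
  proof
    assume "graph_dist G u v \<le> 2"
    then obtain p where p: "apath u p v" "length p \<le> 2"
      unfolding two graph_dist_le_iff by blast
    then consider e where "p = [e]" | e e' where "p = [e, e']"
      using assms by (cases p; cases "tl p") (auto simp: apath_simps)
    then show "u \<rightarrow>\<^bsub>G\<^esub> v \<or> (\<exists>w. u \<rightarrow>\<^bsub>G\<^esub> w \<and> w \<rightarrow>\<^bsub>G\<^esub> v)"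
      using p in_arcs_imp_in_arcs_ends by cases (fastforce simp: apath_simps)+
  next
    assume *: "u \<rightarrow>\<^bsub>G\<^esub> v \<or> (\<exists>w. u \<rightarrow>\<^bsub>G\<^esub> w \<and> w \<rightarrow>\<^bsub>G\<^esub> v)"
    show "graph_dist G u v \<le> 2"
    proof (cases "u \<rightarrow>\<^bsub>G\<^esub> v")
      case True
      then have "graph_dist G u v \<le> 1"
        using assms by (simp add: graph_dist_le_1_iff)
      then show ?thesis
        by (rule order_trans) simp
    next
      case False
      then obtain w where w: "u \<rightarrow>\<^bsub>G\<^esub> w" "w \<rightarrow>\<^bsub>G\<^esub> v" using * by blast
      then have "w \<noteq> u" "w \<noteq> v" using False by auto
      obtain e e' where "e \<in> arcs G" "tail G e = u" "head G e = w"
        "e' \<in> arcs G" "tail G e' = w" "head G e' = v" "v \<in> verts G"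
        using w by (metis dominatesE_arc)
      then have "apath u [e, e'] v"
        using assms \<open>w \<noteq> u\<close> \<open>w \<noteq> v\<close> by (auto simp: apath_simps)
      then show ?thesis
        unfolding two graph_dist_le_iff by (intro exI[of _ "[e, e']"]) auto
    qed
  qed
qed

lemma graph_dist_le_3I:
  assumes "u \<noteq> v" "u \<rightarrow>\<^bsub>G\<^esub> w" "w \<rightarrow>\<^bsub>G\<^esub> x" "x \<rightarrow>\<^bsub>G\<^esub> v"
  shows "graph_dist G u v \<le> 3"
proof (cases "graph_dist G u v \<le> 2")
  case True
  then show ?thesis by (rule order_trans) simp
next
  case False
  then have "\<not> (u \<rightarrow>\<^bsub>G\<^esub> v)" "\<And>y. \<not> (u \<rightarrow>\<^bsub>G\<^esub> y \<and> y \<rightarrow>\<^bsub>G\<^esub> v)"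
    using assms(1) by (auto simp: graph_dist_le_2_iff)
  \<comment> \<open>A walk of length three with no shortcut has four distinct vertices.\<close>
  then have d: "distinct [u, w, x, v]"
    using assms by auto
  have three: "(3::enat) = enat 3" by (simp add: numeral_eq_enat)
  obtain e e' e'' where "e \<in> arcs G" "tail G e = u" "head G e = w"
    "e' \<in> arcs G" "tail G e' = w" "head G e' = x"
    "e'' \<in> arcs G" "tail G e'' = x" "head G e'' = v" "v \<in> verts G"
    using assms by (metis dominatesE_arc)
  then have "apath u [e, e', e''] v"
    using d by (auto simp: apath_simps)
  then show ?thesis
    unfolding three graph_dist_le_iff by (intro exI[of _ "[e, e', e'']"]) auto
qed

end

lemma graph_diam_le_iff:
  "graph_diam G \<le> n \<longleftrightarrow>
     (\<forall>u \<in> verts G. \<forall>v \<in> verts G. u \<noteq> v \<longrightarrow> graph_dist G u v \<le> n)"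
  by (auto simp: graph_diam_def SUP_le_iff)

lemma (in wf_digraph) graph_diam_le_0_iff:
  "graph_diam G \<le> 0 \<longleftrightarrow> (\<forall>u \<in> verts G. \<forall>v \<in> verts G. u = v)"
proof -
  have "\<not> graph_dist G u v \<le> 0" if "u \<noteq> v" for u v
    using that graph_dist_le_iff[of u v 0] by (auto simp: apath_simps zero_enat_def)
  then show ?thesis unfolding graph_diam_le_iff by blast
qed

section \<open>Ideals, annihilators and zero divisors\<close>

context cring
begin

lemma ideal_carrier_mem: "ideal I R \<Longrightarrow> x \<in> I \<Longrightarrow> x \<in> carrier R"
  by (rule ideal.Icarr)

lemma ideal_zero_mem: "ideal I R \<Longrightarrow> \<zero> \<in> I"
  by (simp add: additive_subgroup.zero_closed ideal.axioms(1))

lemma ideal_add_mem: "ideal I R \<Longrightarrow> x \<in> I \<Longrightarrow> y \<in> I \<Longrightarrow> x \<oplus> y \<in> I"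
  by (simp add: additive_subgroup.a_closed ideal.axioms(1))

lemma ideal_nonzero_obtain:
  assumes "ideal I R" "I \<noteq> {\<zero>}"
  obtains x where "x \<in> I" "x \<noteq> \<zero>"
  using assms ideal_zero_mem by blast

lemma ideal_prod_eq_zero_iff:
  assumes "ideal I R" "ideal J R"
  shows "I \<cdot> J = {\<zero>} \<longleftrightarrow> (\<forall>x \<in> I. \<forall>y \<in> J. x \<otimes> y = \<zero>)"
proof
  assume "I \<cdot> J = {\<zero>}"
  then show "\<forall>x \<in> I. \<forall>y \<in> J. x \<otimes> y = \<zero>"
    using ideal_prod.prod by fastforce
next
  assume *: "\<forall>x \<in> I. \<forall>y \<in> J. x \<otimes> y = \<zero>"
  have "s = \<zero>" if "s \<in> I \<cdot> J" for s
    using that by induct (use * in auto)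
  then show "I \<cdot> J = {\<zero>}"
    using ideal_zero_mem[OF ideal_prod_is_ideal[OF assms]] by blast
qed

lemma annihilating_ideal_iff_element:
  "annihilating_ideal R I \<longleftrightarrow>
     ideal I R \<and> (\<exists>a \<in> carrier R. a \<noteq> \<zero> \<and> (\<forall>x \<in> I. x \<otimes> a = \<zero>))"
proof (cases "ideal I R")
  case True
  then have "\<zero> \<in> ann R I"
    using ann_is_ideal ideal_zero_mem by blast
  then show ?thesis
    using True m_comm ideal_carrier_mem[OF True]
    unfolding annihilating_ideal_def ann_def by fastforce
qed (simp add: annihilating_ideal_def)

lemma ideal_subset_sum:
  assumes "ideal I R" "ideal J R"
  shows "I \<subseteq> I <+>\<^bsub>R\<^esub> J" and "J \<subseteq> I <+>\<^bsub>R\<^esub> J"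
proof -
  show "I \<subseteq> I <+>\<^bsub>R\<^esub> J"
  proof
    fix x assume x: "x \<in> I"
    then have "x = x \<oplus> \<zero>" using ideal_carrier_mem[OF assms(1)] by simp
    then show "x \<in> I <+>\<^bsub>R\<^esub> J"
      using x ideal_zero_mem[OF assms(2)] unfolding set_add_def' by blast
  qed
  show "J \<subseteq> I <+>\<^bsub>R\<^esub> J"
  proof
    fix y assume y: "y \<in> J"
    then have "y = \<zero> \<oplus> y" using ideal_carrier_mem[OF assms(2)] by simp
    then show "y \<in> I <+>\<^bsub>R\<^esub> J"
      using y ideal_zero_mem[OF assms(1)] unfolding set_add_def' by blast
  qed
qed

lemma ideal_add_self:
  assumes "ideal I R"
  shows "I <+>\<^bsub>R\<^esub> I = I"
proof
  show "I <+>\<^bsub>R\<^esub> I \<subseteq> I" using ideal_add_mem[OF assms] by (auto simp: set_add_def')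
  show "I \<subseteq> I <+>\<^bsub>R\<^esub> I" by (rule ideal_subset_sum(1)[OF assms assms])
qed

text \<open>Since \<open>Ann(I + J) = Ann(I) \<inter> Ann(J)\<close>, the sum is annihilating when one nonzero element
  kills both summands.\<close>

lemma annihilating_sum_iff:
  assumes "ideal I R" "ideal J R"
  shows "annihilating_ideal R (I <+>\<^bsub>R\<^esub> J) \<longleftrightarrow>
    (\<exists>a \<in> carrier R. a \<noteq> \<zero> \<and> (\<forall>x \<in> I. x \<otimes> a = \<zero>) \<and> (\<forall>y \<in> J. y \<otimes> a = \<zero>))"
proof -
  have eq: "(\<forall>z \<in> I <+>\<^bsub>R\<^esub> J. z \<otimes> a = \<zero>) \<longleftrightarrow> (\<forall>x \<in> I. x \<otimes> a = \<zero>) \<and> (\<forall>y \<in> J. y \<otimes> a = \<zero>)"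
    if "a \<in> carrier R" for a
  proof
    assume *: "\<forall>z \<in> I <+>\<^bsub>R\<^esub> J. z \<otimes> a = \<zero>"
    show "(\<forall>x \<in> I. x \<otimes> a = \<zero>) \<and> (\<forall>y \<in> J. y \<otimes> a = \<zero>)"
      using * ideal_subset_sum[OF assms] by blast
  next
    assume "(\<forall>x \<in> I. x \<otimes> a = \<zero>) \<and> (\<forall>y \<in> J. y \<otimes> a = \<zero>)"
    then show "\<forall>z \<in> I <+>\<^bsub>R\<^esub> J. z \<otimes> a = \<zero>"
      using that ideal_carrier_mem[OF assms(1)] ideal_carrier_mem[OF assms(2)]
      by (auto simp: set_add_def' l_distr)
  qed
  show ?thesis
    using eq add_ideals[OF assms] unfolding annihilating_ideal_iff_element by blast
qed

lemma PIdl_mem_iff: "y \<in> PIdl x \<longleftrightarrow> (\<exists>r \<in> carrier R. y = r \<otimes> x)"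
  by (auto simp: cgenideal_def)

lemma mult_PIdl_zero:
  assumes "x \<in> carrier R" "a \<in> carrier R" "x \<otimes> a = \<zero>" "z \<in> PIdl a"
  shows "x \<otimes> z = \<zero>" "z \<otimes> x = \<zero>"
proof -
  obtain r where r: "r \<in> carrier R" "z = r \<otimes> a"
    using assms(4) by (auto simp: PIdl_mem_iff)
  show "x \<otimes> z = \<zero>"
    using m_lcomm[of x r a] assms r by simp
  then show "z \<otimes> x = \<zero>"
    using assms r by (simp add: m_comm)
qed

lemma PIdl_neq_zero: "x \<in> carrier R \<Longrightarrow> x \<noteq> \<zero> \<Longrightarrow> PIdl x \<noteq> {\<zero>}"
  using cgenideal_self by blast

lemma vertex_iff:
  "I \<in> nonzero_annihilating_ideals R \<longleftrightarrow>
     ideal I R \<and> I \<noteq> {\<zero>} \<and> (\<exists>a \<in> carrier R. a \<noteq> \<zero> \<and> (\<forall>x \<in> I. x \<otimes> a = \<zero>))"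
  by (auto simp: nonzero_annihilating_ideals_def annihilating_ideal_iff_element)

lemma vertex_proper:
  assumes "I \<in> nonzero_annihilating_ideals R"
  shows "\<one> \<notin> I"
  using assms by (auto simp: vertex_iff)

text \<open>The unit ideal is annihilated by nothing but zero.\<close>

lemma vertices_subset_proper_ideals:
  "nonzero_annihilating_ideals R \<subseteq> nonzero_proper_ideals R"
proof
  fix I assume I: "I \<in> nonzero_annihilating_ideals R"
  then have "I \<noteq> carrier R" using vertex_proper by blast
  then show "I \<in> nonzero_proper_ideals R"
    using I by (simp add: vertex_iff nonzero_proper_ideals_def)
qed

lemma annihilating_subset_zero_divisors:
  assumes "annihilating_ideal R I"
  shows "I \<subseteq> zero_divisors R"
  using assms ideal_carrier_mem
  by (auto simp: annihilating_ideal_iff_element zero_divisors_def)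

lemma vertex_subset_zero_divisors:
  "I \<in> nonzero_annihilating_ideals R \<Longrightarrow> I \<subseteq> zero_divisors R"
  by (simp add: nonzero_annihilating_ideals_def annihilating_subset_zero_divisors)

lemma PIdl_annihilating:
  assumes "x \<in> zero_divisors R"
  shows "annihilating_ideal R (PIdl x)"
proof -
  obtain y where y: "y \<in> carrier R" "y \<noteq> \<zero>" "x \<otimes> y = \<zero>" and x: "x \<in> carrier R"
    using assms by (auto simp: zero_divisors_def)
  have "z \<otimes> y = \<zero>" if "z \<in> PIdl x" for z
    using that x y by (auto simp: PIdl_mem_iff m_assoc)
  then show ?thesis
    using x y cgenideal_ideal by (auto simp: annihilating_ideal_iff_element)
qed

lemma PIdl_vertex:
  assumes "x \<in> zero_divisors R" "x \<noteq> \<zero>"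
  shows "PIdl x \<in> nonzero_annihilating_ideals R"
  using PIdl_annihilating[OF assms(1)] PIdl_neq_zero assms
  by (auto simp: nonzero_annihilating_ideals_def zero_divisors_def)

lemma vertex_if_product_zero:
  assumes "ideal I R" "I \<noteq> {\<zero>}" "ideal J R" "J \<noteq> {\<zero>}" "I \<cdot> J = {\<zero>}"
  shows "I \<in> nonzero_annihilating_ideals R"
  using assms annihilating_ideal_iff by (auto simp: nonzero_annihilating_ideals_def)

lemma ann_eq: "ideal I R \<Longrightarrow> ann R I = {a \<in> carrier R. \<forall>x \<in> I. x \<otimes> a = \<zero>}"
  using ideal_carrier_mem m_comm by (fastforce simp: ann_def)

lemma ann_vertex:
  assumes "I \<in> nonzero_annihilating_ideals R"
  shows "ann R I \<in> nonzero_annihilating_ideals R" and "I \<cdot> ann R I = {\<zero>}"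
proof -
  have I: "ideal I R" "I \<noteq> {\<zero>}" "ann R I \<noteq> {\<zero>}"
    using assms by (auto simp: nonzero_annihilating_ideals_def annihilating_ideal_def)
  show 0: "I \<cdot> ann R I = {\<zero>}"
    using ideal_prod_eq_zero_iff[OF I(1) ann_is_ideal[OF I(1)]] by (simp add: ann_eq[OF I(1)])
  show "ann R I \<in> nonzero_annihilating_ideals R"
    using vertex_if_product_zero[of "ann R I" I] I 0 ann_is_ideal[OF I(1)]
      ideal_prod_commute[OF I(1) ann_is_ideal[OF I(1)]] by simp
qed

section \<open>Distances in the annihilating-ideal graph\<close>

lemma dominates_iff:
  "I \<rightarrow>\<^bsub>annihilating_ideal_graph R\<^esub> J \<longleftrightarrow>
     I \<in> nonzero_annihilating_ideals R \<and> J \<in> nonzero_annihilating_ideals R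
       \<and> I \<noteq> J \<and> I \<cdot> J = {\<zero>}"
  by (auto simp: annihilating_ideal_graph_def arcs_ends_conv image_iff)

lemma verts_graph [simp]:
  "verts (annihilating_ideal_graph R) = nonzero_annihilating_ideals R"
  by (simp add: annihilating_ideal_graph_def)

lemma wf_graph: "wf_digraph (annihilating_ideal_graph R)"
  using annihilating_ideal_graph_simple(2) by (simp add: loopfree_digraph_def)

lemma diam_le_0_iff:
  "graph_diam (annihilating_ideal_graph R) \<le> 0 \<longleftrightarrow>
     (\<forall>I \<in> nonzero_annihilating_ideals R. \<forall>J \<in> nonzero_annihilating_ideals R. I = J)"
  using wf_digraph.graph_diam_le_0_iff[OF wf_graph] by simp

lemma diam_le_1_iff:
  "graph_diam (annihilating_ideal_graph R) \<le> 1 \<longleftrightarrow>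
     (\<forall>I \<in> nonzero_annihilating_ideals R. \<forall>J \<in> nonzero_annihilating_ideals R.
        I \<noteq> J \<longrightarrow> I \<cdot> J = {\<zero>})"
  by (auto simp: graph_diam_le_iff wf_digraph.graph_dist_le_1_iff[OF wf_graph] dominates_iff)

text \<open>A nonzero element killing both \<open>I\<close> and \<open>J\<close> generates a common neighbour, and conversely
  every element of a common neighbour kills both.\<close>

lemma dist_le_2_iff:
  assumes I: "I \<in> nonzero_annihilating_ideals R" and J: "J \<in> nonzero_annihilating_ideals R"
    and "I \<noteq> J"
  shows "graph_dist (annihilating_ideal_graph R) I J \<le> 2 \<longleftrightarrow>
     I \<cdot> J = {\<zero>} \<or> annihilating_ideal R (I <+>\<^bsub>R\<^esub> J)"
proof -
  have ids: "ideal I R" "ideal J R" using I J by (auto simp: vertex_iff)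
  have through: "annihilating_ideal R (I <+>\<^bsub>R\<^esub> J)"
    if K: "K \<in> nonzero_annihilating_ideals R" "I \<cdot> K = {\<zero>}" "K \<cdot> J = {\<zero>}" for K
  proof -
    have K': "ideal K R" "K \<noteq> {\<zero>}" using K by (auto simp: vertex_iff)
    then obtain k where k: "k \<in> K" "k \<noteq> \<zero>" by (rule ideal_nonzero_obtain)
    have kc: "k \<in> carrier R" using K' k ideal_carrier_mem by blast
    have "\<forall>x \<in> I. x \<otimes> k = \<zero>" and "\<forall>y \<in> J. k \<otimes> y = \<zero>"
      using K k by (auto simp: ideal_prod_eq_zero_iff ids K')
    moreover from this have "\<forall>y \<in> J. y \<otimes> k = \<zero>"
      using kc m_comm ideal_carrier_mem[OF ids(2)] by metis
    ultimately show ?thesis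
      using kc k unfolding annihilating_sum_iff[OF ids] by blast
  qed
  have middle: "\<exists>K. I \<rightarrow>\<^bsub>annihilating_ideal_graph R\<^esub> K \<and> K \<rightarrow>\<^bsub>annihilating_ideal_graph R\<^esub> J"
    if ann: "annihilating_ideal R (I <+>\<^bsub>R\<^esub> J)" and ne: "I \<cdot> J \<noteq> {\<zero>}"
  proof -
    obtain a where a: "a \<in> carrier R" "a \<noteq> \<zero>" "\<forall>x \<in> I. x \<otimes> a = \<zero>" "\<forall>y \<in> J. y \<otimes> a = \<zero>"
      using ann unfolding annihilating_sum_iff[OF ids] by blast
    let ?K = "PIdl a"
    have K: "ideal ?K R" "?K \<noteq> {\<zero>}"
      using a cgenideal_ideal PIdl_neq_zero by auto
    have IK: "I \<cdot> ?K = {\<zero>}" and KJ: "?K \<cdot> J = {\<zero>}"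
      using a ideal_carrier_mem[OF ids(1)] ideal_carrier_mem[OF ids(2)]
      by (auto simp: ideal_prod_eq_zero_iff ids K intro: mult_PIdl_zero[of _ a])
    have "?K \<in> nonzero_annihilating_ideals R"
      using vertex_if_product_zero K KJ ids J by (auto simp: vertex_iff)
    \<comment> \<open>If \<open>I\<close> or \<open>J\<close> were this ideal, then \<open>I\<close> and \<open>J\<close> would be adjacent already.\<close>
    then have "I \<rightarrow>\<^bsub>annihilating_ideal_graph R\<^esub> ?K" "?K \<rightarrow>\<^bsub>annihilating_ideal_graph R\<^esub> J"
      using IK KJ ne I J by (auto simp: dominates_iff)
    then show ?thesis by blast
  qed
  show ?thesis
  proof (cases "I \<cdot> J = {\<zero>}")
    case True
    then show ?thesis
      using I J \<open>I \<noteq> J\<close>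
      by (simp add: wf_digraph.graph_dist_le_2_iff[OF wf_graph] dominates_iff)
  next
    case False
    show ?thesis
    proof
      assume "graph_dist (annihilating_ideal_graph R) I J \<le> 2"
      then obtain K where "K \<in> nonzero_annihilating_ideals R" "I \<cdot> K = {\<zero>}" "K \<cdot> J = {\<zero>}"
        using False \<open>I \<noteq> J\<close>
        by (auto simp: wf_digraph.graph_dist_le_2_iff[OF wf_graph] dominates_iff)
      then show "I \<cdot> J = {\<zero>} \<or> annihilating_ideal R (I <+>\<^bsub>R\<^esub> J)"
        by (rule disjI2[OF through])
    next
      assume "I \<cdot> J = {\<zero>} \<or> annihilating_ideal R (I <+>\<^bsub>R\<^esub> J)"
      then show "graph_dist (annihilating_ideal_graph R) I J \<le> 2"
        using middle False \<open>I \<noteq> J\<close>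
        unfolding wf_digraph.graph_dist_le_2_iff[OF wf_graph \<open>I \<noteq> J\<close>] by blast
    qed
  qed
qed

lemma diam_le_2_iff:
  "graph_diam (annihilating_ideal_graph R) \<le> 2 \<longleftrightarrow>
     (\<forall>I \<in> nonzero_annihilating_ideals R. \<forall>J \<in> nonzero_annihilating_ideals R.
        I \<noteq> J \<longrightarrow> I \<cdot> J = {\<zero>} \<or> annihilating_ideal R (I <+>\<^bsub>R\<^esub> J))"
  unfolding graph_diam_le_iff verts_graph
  by (intro ball_cong imp_cong refl dist_le_2_iff)

text \<open>Two vertices at distance greater than two have annihilators that meet only in \<open>\<zero>\<close>;
  these annihilators then multiply to zero and are the inner vertices of a path of length
  three.\<close>

lemma diam_le_3: "graph_diam (annihilating_ideal_graph R) \<le> 3"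
  unfolding graph_diam_le_iff verts_graph
proof (intro ballI impI)
  fix I J
  assume I: "I \<in> nonzero_annihilating_ideals R" and J: "J \<in> nonzero_annihilating_ideals R"
    and "I \<noteq> J"
  let ?d = "graph_dist (annihilating_ideal_graph R) I J"
  show "?d \<le> 3"
  proof (cases "?d \<le> 2")
    case True
    then show ?thesis by (rule order_trans) simp
  next
    case False
    have ids: "ideal I R" "ideal J R" using I J by (auto simp: vertex_iff)
    let ?A = "ann R I" and ?B = "ann R J"
    have AB: "ideal ?A R" "ideal ?B R" using ids ann_is_ideal by auto
    have AV: "?A \<in> nonzero_annihilating_ideals R" "I \<cdot> ?A = {\<zero>}"
      and BV: "?B \<in> nonzero_annihilating_ideals R" "?B \<cdot> J = {\<zero>}"
      using ann_vertex[OF I] ann_vertex[OF J] ideal_prod_commute[OF ids(2) AB(2)] by auto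
    have ne: "I \<cdot> J \<noteq> {\<zero>}" and na: "\<not> annihilating_ideal R (I <+>\<^bsub>R\<^esub> J)"
      using False dist_le_2_iff[OF I J \<open>I \<noteq> J\<close>] by auto
    have meet: "?A \<inter> ?B \<subseteq> {\<zero>}"
      using na ids unfolding annihilating_sum_iff[OF ids] by (auto simp: ann_eq)
    have prod: "?A \<cdot> ?B = {\<zero>}"
      using ideal_prod_inter[OF AB] meet ideal_zero_mem[OF ideal_prod_is_ideal[OF AB]] by blast
    have nz: "\<not> ?A \<subseteq> {\<zero>}" "\<not> ?B \<subseteq> {\<zero>}"
      using AV(1) BV(1) AB ideal_zero_mem unfolding vertex_iff by blast+
    have mult0: "x \<otimes> y = \<zero>" if "x \<in> ?A" "y \<in> ?B" for x y
      using prod that ideal_prod_eq_zero_iff[OF AB] by blast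
    have "?A \<noteq> ?B"
      using meet nz by blast
    moreover have "?A \<noteq> I"
    proof
      assume "?A = I"
      then have "?B \<subseteq> ?A"
        using mult0 ideal_carrier_mem[OF AB(2)] unfolding ann_eq[OF ids(1)] by blast
      then show False
        using meet nz by blast
    qed
    moreover have "?B \<noteq> J"
    proof
      assume "?B = J"
      then have "?A \<subseteq> ?B"
        using mult0 ideal_carrier_mem[OF AB(1)] unfolding ann_def by blast
      then show False
        using meet nz by blast
    qed
    ultimately show ?thesis
      using I J \<open>I \<noteq> J\<close> AV BV prod
      by (intro wf_digraph.graph_dist_le_3I[OF wf_graph, of _ _ ?A ?B]) (auto simp: dominates_iff)
  qed
qed

section \<open>Minimal primes of a reduced ring\<close>

lemma reduced_ring_iff_square:
  "reduced_ring R \<longleftrightarrow> (\<forall>y \<in> carrier R. y \<otimes> y = \<zero> \<longrightarrow> y = \<zero>)"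
proof
  assume red: "reduced_ring R"
  show "\<forall>y \<in> carrier R. y \<otimes> y = \<zero> \<longrightarrow> y = \<zero>"
  proof (intro ballI impI)
    fix y assume "y \<in> carrier R" "y \<otimes> y = \<zero>"
    then have "y [^] (Suc (Suc 0)) = \<zero>" by simp
    then show "y = \<zero>"
      using red \<open>y \<in> carrier R\<close> unfolding reduced_ring_def by blast
  qed
next
  assume sq: "\<forall>y \<in> carrier R. y \<otimes> y = \<zero> \<longrightarrow> y = \<zero>"
  have "x = \<zero>" if x: "x \<in> carrier R" and "x [^] n = \<zero>" for x and n :: nat
    using that(2)
  proof (induction n)
    case 0
    then show ?case using x l_one[OF x] l_null[OF x] by simp
  next
    case (Suc n)
    show ?case
    proof (cases n)
      case 0
      then show ?thesis using Suc.prems x by simp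
    next
      case (Suc m)
      have "x [^] n \<otimes> x [^] n = (x [^] n \<otimes> x) \<otimes> x [^] m"
        using x unfolding Suc by (simp add: m_assoc m_lcomm m_comm)
      also have "\<dots> = \<zero>"
        using Suc.prems x by simp
      finally have "x [^] n = \<zero>"
        using sq nat_pow_closed[OF x] by blast
      then show ?thesis
        by (rule Suc.IH)
    qed
  qed
  then show "reduced_ring R"
    by (simp add: reduced_ring_def)
qed

lemma minimal_primeD:
  assumes "P \<in> minimal_primes R"
  shows "ideal P R" and "\<one> \<notin> P"
    and "\<And>a b. a \<in> carrier R \<Longrightarrow> b \<in> carrier R \<Longrightarrow> a \<otimes> b \<in> P \<Longrightarrow> a \<in> P \<or> b \<in> P"
proof -
  interpret P: primeideal P R
    using assms by (simp add: minimal_primes_def)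
  show "ideal P R" by (rule P.is_ideal)
  show "\<one> \<notin> P" using P.one_imp_carrier P.I_notcarr by blast
  show "\<And>a b. a \<in> carrier R \<Longrightarrow> b \<in> carrier R \<Longrightarrow> a \<otimes> b \<in> P \<Longrightarrow> a \<in> P \<or> b \<in> P"
    by (rule P.I_prime)
qed

lemma minimal_primes_incomparable:
  assumes "P \<in> minimal_primes R" "Q \<in> minimal_primes R" "Q \<subseteq> P"
  shows "Q = P"
  using assms by (auto simp: minimal_primes_def)

text \<open>The sets to which Zorn's lemma is applied: a maximal member has a minimal prime as its
  complement.\<close>

definition mult_closed_nonzero :: "'a set \<Rightarrow> bool" where
  "mult_closed_nonzero S \<longleftrightarrow> S \<subseteq> carrier R \<and> \<one> \<in> S \<and> \<zero> \<notin> S \<and> (\<forall>x \<in> S. \<forall>y \<in> S. x \<otimes> y \<in> S)"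

lemma powers_mult_closed_nonzero:
  assumes "reduced_ring R" "a \<in> carrier R" "a \<noteq> \<zero>"
  shows "mult_closed_nonzero {a [^] n |n::nat. True}"
  unfolding mult_closed_nonzero_def
proof (intro conjI ballI)
  show "{a [^] n |n::nat. True} \<subseteq> carrier R" using assms by auto
  show "\<one> \<in> {a [^] n |n::nat. True}" by (auto intro: exI[of _ 0])
  show "\<zero> \<notin> {a [^] n |n::nat. True}"
    using assms unfolding reduced_ring_def by fastforce
  show "x \<otimes> y \<in> {a [^] n |n::nat. True}"
    if "x \<in> {a [^] n |n::nat. True}" "y \<in> {a [^] n |n::nat. True}" for x y
    using that assms(2) nat_pow_mult[of a] by auto
qed

lemma maximal_mult_closed_exists:
  assumes "mult_closed_nonzero S\<^sub>0"
  obtains S where "S\<^sub>0 \<subseteq> S" "mult_closed_nonzero S"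
    "\<And>T. mult_closed_nonzero T \<Longrightarrow> S \<subseteq> T \<Longrightarrow> T = S"
proof -
  let ?C = "{S. mult_closed_nonzero S \<and> S\<^sub>0 \<subseteq> S}"
  have "\<exists>S \<in> ?C. \<forall>T \<in> ?C. S \<subseteq> T \<longrightarrow> T = S"
  proof (rule subset_Zorn_nonempty)
    show "?C \<noteq> {}" using assms by blast
  next
    fix \<C> assume ne: "\<C> \<noteq> {}" and chain: "subset.chain ?C \<C>"
    have closed: "x \<otimes> y \<in> \<Union>\<C>" if xy: "x \<in> \<Union>\<C>" "y \<in> \<Union>\<C>" for x y
    proof -
      obtain A B where A: "A \<in> \<C>" "x \<in> A" and B: "B \<in> \<C>" "y \<in> B" using xy by blast
      then obtain D where D: "D \<in> \<C>" "A \<subseteq> D" "B \<subseteq> D"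
        using chain by (metis order_refl subset_chain_def)
      then have "mult_closed_nonzero D" using chain by (auto simp: subset_chain_def)
      then show ?thesis
        using A B D unfolding mult_closed_nonzero_def by blast
    qed
    have members: "mult_closed_nonzero A" "S\<^sub>0 \<subseteq> A" if "A \<in> \<C>" for A
      using chain that by (auto simp: subset_chain_def)
    have "\<Union>\<C> \<subseteq> carrier R" "\<zero> \<notin> \<Union>\<C>"
      using members(1) unfolding mult_closed_nonzero_def by blast+
    moreover have "\<one> \<in> \<Union>\<C>" "S\<^sub>0 \<subseteq> \<Union>\<C>"
      using ne members unfolding mult_closed_nonzero_def by blast+
    ultimately show "\<Union>\<C> \<in> ?C"
      using closed by (simp add: mult_closed_nonzero_def)
  qed
  then obtain S where S: "S \<in> ?C" and max: "\<forall>T \<in> ?C. S \<subseteq> T \<longrightarrow> T = S" ..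
  show ?thesis
  proof (rule that)
    show "S\<^sub>0 \<subseteq> S" "mult_closed_nonzero S" using S by simp_all
    fix T assume T: "mult_closed_nonzero T" "S \<subseteq> T"
    then have "T \<in> ?C" using \<open>S\<^sub>0 \<subseteq> S\<close> by simp
    then show "T = S" using max T(2) by simp
  qed
qed

text \<open>Adjoining the powers of \<open>x\<close> to \<open>S\<close> must produce zero by maximality, say \<open>s x\<^sup>n = \<zero>\<close>; then
  \<open>s x\<close> is nilpotent, hence zero.\<close>

lemma reduced_annihilated_outside_maximal_mult_closed:
  assumes red: "reduced_ring R" and S: "mult_closed_nonzero S"
    and max: "\<And>T. mult_closed_nonzero T \<Longrightarrow> S \<subseteq> T \<Longrightarrow> T = S"
    and x: "x \<in> carrier R" "x \<notin> S"
  shows "\<exists>s \<in> S. s \<otimes> x = \<zero>"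
proof -
  have Sc: "\<And>s. s \<in> S \<Longrightarrow> s \<in> carrier R" using S by (auto simp: mult_closed_nonzero_def)
  define T where "T = {s \<otimes> x [^] n |s n. s \<in> S \<and> n \<in> (UNIV :: nat set)}"
  have T_mem: "s \<otimes> x [^] n \<in> T" if "s \<in> S" for s and n :: nat
    using that by (auto simp: T_def)
  have "S \<subseteq> T"
  proof
    fix s assume "s \<in> S"
    then show "s \<in> T" using T_mem[of s 0] Sc by simp
  qed
  moreover have "x \<in> T"
    using T_mem[of \<one> 1] S x by (simp add: mult_closed_nonzero_def)
  ultimately have "\<not> mult_closed_nonzero T"
    using max x(2) by blast
  moreover have "T \<subseteq> carrier R" "\<one> \<in> T"
    using Sc x \<open>S \<subseteq> T\<close> S by (auto simp: T_def mult_closed_nonzero_def)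
  moreover have "u \<otimes> v \<in> T" if uv: "u \<in> T" "v \<in> T" for u v
  proof -
    obtain s t m n where u: "u = s \<otimes> x [^] (m::nat)" "s \<in> S" and v: "v = t \<otimes> x [^] (n::nat)" "t \<in> S"
      using uv unfolding T_def by blast
    have "u \<otimes> v = (s \<otimes> t) \<otimes> (x [^] m \<otimes> x [^] n)"
      using u v Sc x by (simp add: m_assoc m_lcomm)
    then have "u \<otimes> v = (s \<otimes> t) \<otimes> x [^] (m + n)"
      using x by (simp add: nat_pow_mult)
    then show ?thesis
      using T_mem[of "s \<otimes> t" "m + n"] u v S by (simp add: mult_closed_nonzero_def)
  qed
  ultimately have "\<zero> \<in> T"
    by (auto simp: mult_closed_nonzero_def)
  then obtain s n where s: "s \<in> S" "s \<otimes> x [^] (n::nat) = \<zero>"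
    unfolding T_def by fastforce
  have n: "n \<noteq> 0"
  proof
    assume "n = 0"
    then have "s = \<zero>" using s Sc by simp
    then show False using s(1) S by (simp add: mult_closed_nonzero_def)
  qed
  then obtain m where m: "n = Suc m" by (cases n) auto
  have "(s \<otimes> x) [^] n = s [^] n \<otimes> x [^] n"
    using s(1) Sc x by (simp add: nat_pow_distrib)
  also have "s [^] n = s [^] m \<otimes> s"
    by (simp add: m)
  also have "s [^] m \<otimes> s \<otimes> x [^] n = s [^] m \<otimes> (s \<otimes> x [^] n)"
    using s(1) Sc x by (simp add: m_assoc)
  finally have "(s \<otimes> x) [^] n = s [^] m \<otimes> (s \<otimes> x [^] n)" .
  then have "(s \<otimes> x) [^] n = \<zero>"
    using s Sc x by simp
  then have "s \<otimes> x = \<zero>"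
    using red s(1) Sc x unfolding reduced_ring_def by blast
  then show ?thesis using s by blast
qed

text \<open>The complement of a maximal multiplicatively closed set \<open>S\<close> avoiding \<open>\<zero>\<close> is a minimal
  prime. In a reduced ring this needs no binomial expansion, since that complement consists of the
  elements annihilated by a member of \<open>S\<close>.\<close>

lemma reduced_complement_minimal_prime:
  assumes red: "reduced_ring R" and S: "mult_closed_nonzero S"
    and max: "\<And>T. mult_closed_nonzero T \<Longrightarrow> S \<subseteq> T \<Longrightarrow> T = S"
  shows "carrier R - S \<in> minimal_primes R"
proof -
  let ?P = "carrier R - S"
  have Sc: "\<And>s. s \<in> S \<Longrightarrow> s \<in> carrier R"
    and S0: "\<zero> \<notin> S" and S1: "\<one> \<in> S" and Sm: "\<And>s t. s \<in> S \<Longrightarrow> t \<in> S \<Longrightarrow> s \<otimes> t \<in> S"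
    using S by (auto simp: mult_closed_nonzero_def)
  have mem: "x \<in> ?P \<longleftrightarrow> (\<exists>s \<in> S. s \<otimes> x = \<zero>)" if "x \<in> carrier R" for x
    using reduced_annihilated_outside_maximal_mult_closed[OF assms that] that Sm S0 by fastforce
  have mult: "r \<otimes> x \<in> ?P" if xP: "x \<in> ?P" and r: "r \<in> carrier R" for x r
  proof -
    obtain s where s: "s \<in> S" "s \<otimes> x = \<zero>" using mem xP by blast
    then have "s \<otimes> (r \<otimes> x) = \<zero>"
      using m_lcomm[of s r x] Sc r xP by simp
    then show ?thesis using mem s(1) r xP by blast
  qed
  have "ideal ?P R"
  proof (rule idealI[OF ring_axioms])
    show "subgroup ?P (add_monoid R)"
    proof (rule add.subgroupI)
      show "?P \<noteq> {}" using S0 by blast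
      show "\<ominus> x \<in> ?P" if "x \<in> ?P" for x
        using mult[OF that, of "\<ominus> \<one>"] that by (simp add: l_minus)
      show "x \<oplus> y \<in> ?P" if xy: "x \<in> ?P" "y \<in> ?P" for x y
      proof -
        obtain s t where s: "s \<in> S" "s \<otimes> x = \<zero>" and t: "t \<in> S" "t \<otimes> y = \<zero>"
          using mem xy by blast
        have "(s \<otimes> t) \<otimes> (x \<oplus> y) = t \<otimes> (s \<otimes> x) \<oplus> s \<otimes> (t \<otimes> y)"
          using s(1) t(1) xy Sc by (simp add: r_distr m_assoc m_lcomm)
        also have "\<dots> = \<zero>" using s t Sc by simp
        finally show ?thesis using mem[of "x \<oplus> y"] Sm[OF s(1) t(1)] xy by blast
      qed
    qed auto
    show "r \<otimes> x \<in> ?P" if "x \<in> ?P" "r \<in> carrier R" for x r by (rule mult[OF that])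
    then show "x \<otimes> r \<in> ?P" if "x \<in> ?P" "r \<in> carrier R" for x r
      using that m_comm by fastforce
  qed
  then have prime: "primeideal ?P R"
    using S1 Sm by (intro primeidealI[OF _ is_cring]) auto
  have "Q = ?P" if Q: "primeideal Q R" "Q \<subseteq> ?P" for Q
  proof -
    interpret Q: primeideal Q R by (rule Q(1))
    have "x \<in> Q" if x: "x \<in> ?P" for x
    proof -
      obtain s where s: "s \<in> S" "s \<otimes> x = \<zero>" using mem x by blast
      then have "s \<otimes> x \<in> Q" using ideal_zero_mem[OF Q.is_ideal] by simp
      then show ?thesis using Q.I_prime[of s x] s(1) Sc x Q(2) by blast
    qed
    then show ?thesis using Q(2) by blast
  qed
  then show ?thesis using prime by (simp add: minimal_primes_def)
qed

text \<open>The form in which the vanishing of the intersection of all minimal primes is used.\<close>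

lemma reduced_minimal_primes_avoid:
  assumes "reduced_ring R" "a \<in> carrier R" "a \<noteq> \<zero>"
  obtains P where "P \<in> minimal_primes R" "a \<notin> P"
proof -
  obtain S where S: "{a [^] n |n::nat. True} \<subseteq> S" "mult_closed_nonzero S"
    "\<And>T. mult_closed_nonzero T \<Longrightarrow> S \<subseteq> T \<Longrightarrow> T = S"
    using maximal_mult_closed_exists[OF powers_mult_closed_nonzero[OF assms]] by blast
  have "a [^] (1::nat) \<in> {a [^] n |n::nat. True}" by blast
  then have "a \<in> S" using S(1) assms(2) by (auto simp: nat_pow_eone)
  then show ?thesis
    using that reduced_complement_minimal_prime[OF assms(1) S(2,3)] by blast
qed

text \<open>Pick from each of the finitely many primes an element outside \<open>P\<close> and multiply them. For
  \<open>F\<close> the set of all other minimal primes of a reduced ring, the product annihilates \<open>P\<close>.\<close>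

lemma prime_avoids_finite_intersection:
  assumes "finite F" "P \<in> minimal_primes R" "F \<subseteq> minimal_primes R" "P \<notin> F"
  shows "\<exists>x \<in> carrier R. x \<notin> P \<and> (\<forall>Q \<in> F. x \<in> Q)"
  using assms
proof (induction F rule: finite_induct)
  case empty
  then show ?case using minimal_primeD(2) by blast
next
  case (insert Q F)
  then obtain x where x: "x \<in> carrier R" "x \<notin> P" "\<forall>Q \<in> F. x \<in> Q" by blast
  have Q: "Q \<in> minimal_primes R" "Q \<noteq> P" using insert.prems by auto
  then obtain y where y: "y \<in> Q" "y \<notin> P"
    using minimal_primes_incomparable insert.prems(1) by blast
  then have yc: "y \<in> carrier R" using ideal_carrier_mem[OF minimal_primeD(1)[OF Q(1)]] by blast
  have "x \<otimes> y \<notin> P"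
    using minimal_primeD(3)[OF insert.prems(1)] x y yc by blast
  moreover have "x \<otimes> y \<in> Q"
    using ideal.I_l_closed[OF minimal_primeD(1)[OF Q(1)]] y x by blast
  moreover have "x \<otimes> y \<in> Q'" if "Q' \<in> F" for Q'
    using ideal.I_r_closed[OF minimal_primeD(1)] that insert.prems(2) x yc by blast
  ultimately show ?case using x yc by (intro bexI[of _ "x \<otimes> y"]) auto
qed

text \<open>If \<open>x a = \<zero>\<close> with both factors nonzero, a minimal prime avoiding \<open>a\<close> contains \<open>x\<close> and so
  differs from one avoiding \<open>x\<close>.\<close>

lemma reduced_at_least_two_minimal_primes:
  assumes red: "reduced_ring R" and fin: "finite (minimal_primes R)"
    and ne: "nonzero_annihilating_ideals R \<noteq> {}"
  shows "card (minimal_primes R) \<ge> 2"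
proof -
  obtain I where "I \<in> nonzero_annihilating_ideals R" using ne by blast
  then have I: "ideal I R" "I \<noteq> {\<zero>}"
    and "\<exists>a \<in> carrier R. a \<noteq> \<zero> \<and> (\<forall>x \<in> I. x \<otimes> a = \<zero>)" by (auto simp: vertex_iff)
  then obtain a where a: "a \<in> carrier R" "a \<noteq> \<zero>" "\<forall>x \<in> I. x \<otimes> a = \<zero>" by blast
  obtain x where x: "x \<in> I" "x \<noteq> \<zero>" using ideal_nonzero_obtain I by blast
  have xc: "x \<in> carrier R" using x I ideal_carrier_mem by blast
  obtain P where P: "P \<in> minimal_primes R" "a \<notin> P"
    using reduced_minimal_primes_avoid[OF red a(1,2)] .
  obtain Q where Q: "Q \<in> minimal_primes R" "x \<notin> Q"
    using reduced_minimal_primes_avoid[OF red xc x(2)] .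
  have "x \<otimes> a \<in> P"
    using a(3) x ideal_zero_mem[OF minimal_primeD(1)[OF P(1)]] by simp
  then have "x \<in> P" using minimal_primeD(3)[OF P(1) xc a(1)] P(2) by blast
  then have "P \<noteq> Q" using Q by blast
  then show ?thesis
    using card_mono[OF fin, of "{P, Q}"] P Q by simp
qed

text \<open>Two minimal primes are the witnesses. Each is annihilating, a third minimal prime prevents
  their product from vanishing, and an annihilator of their sum would lie in every minimal
  prime, because no minimal prime contains both.\<close>

lemma reduced_many_minimal_primes:
  assumes red: "reduced_ring R" and fin: "finite (minimal_primes R)"
    and card: "card (minimal_primes R) > 2"
  shows "\<exists>I \<in> nonzero_annihilating_ideals R. \<exists>J \<in> nonzero_annihilating_ideals R.
    I \<noteq> J \<and> I \<cdot> J \<noteq> {\<zero>} \<and> \<not> annihilating_ideal R (I <+>\<^bsub>R\<^esub> J)"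
proof -
  have "3 \<le> card (minimal_primes R)" using card by simp
  then obtain F where "F \<subseteq> minimal_primes R" "card F = 3" 
    using obtain_subset_with_card_n by metis
  then obtain P Q N where PQN: "P \<in> minimal_primes R" "Q \<in> minimal_primes R" "N \<in> minimal_primes R"
    "P \<noteq> Q" "P \<noteq> N" "Q \<noteq> N"
    by (auto simp: card_3_iff)
  note ids = minimal_primeD(1)[OF PQN(1)] minimal_primeD(1)[OF PQN(2)]
  have vertex: "P \<in> nonzero_annihilating_ideals R"
    if P: "P \<in> minimal_primes R" and Q: "Q \<in> minimal_primes R" "Q \<noteq> P" for P Q
  proof -
    have idP: "ideal P R" using minimal_primeD(1)[OF P] .
    obtain a where a: "a \<in> carrier R" "a \<notin> P" "\<forall>Q \<in> minimal_primes R - {P}. a \<in> Q"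
      using prime_avoids_finite_intersection[of "minimal_primes R - {P}" P] fin P by auto
    have "a \<noteq> \<zero>" using a(2) ideal_zero_mem[OF idP] by blast
    moreover have "x \<otimes> a = \<zero>" if x: "x \<in> P" for x
    proof (rule ccontr)
      assume "x \<otimes> a \<noteq> \<zero>"
      then obtain N where N: "N \<in> minimal_primes R" "x \<otimes> a \<notin> N"
        using reduced_minimal_primes_avoid[OF red] ideal_carrier_mem[OF idP x] a(1) by blast
      then have "x \<notin> N" "a \<notin> N"
        using ideal.I_r_closed[OF minimal_primeD(1)[OF N(1)], of x a]
          ideal.I_l_closed[OF minimal_primeD(1)[OF N(1)], of a x] a(1) ideal_carrier_mem[OF idP x]
        by auto
      then show False using a(3) N(1) x by blast
    qed
    moreover have "P \<noteq> {\<zero>}"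
      using minimal_primes_incomparable[OF Q(1) P] Q ideal_zero_mem[OF minimal_primeD(1)[OF Q(1)]]
      by blast
    ultimately show ?thesis using idP a(1) by (auto simp: vertex_iff)
  qed
  obtain x where x: "x \<in> P" "x \<notin> N"
    using minimal_primes_incomparable[OF PQN(3,1)] PQN(5) by blast
  obtain y where y: "y \<in> Q" "y \<notin> N"
    using minimal_primes_incomparable[OF PQN(3,2)] PQN(6) by blast
  have "x \<otimes> y \<notin> N"
    using minimal_primeD(3)[OF PQN(3)] x y ideal_carrier_mem ids by blast
  then have "x \<otimes> y \<noteq> \<zero>"
    using ideal_zero_mem[OF minimal_primeD(1)[OF PQN(3)]] by metis
  then have "P \<cdot> Q \<noteq> {\<zero>}"
    using x y ideal_prod_eq_zero_iff[OF ids] by blast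
  moreover have "\<not> annihilating_ideal R (P <+>\<^bsub>R\<^esub> Q)"
  proof
    assume "annihilating_ideal R (P <+>\<^bsub>R\<^esub> Q)"
    then obtain a where a: "a \<in> carrier R" "a \<noteq> \<zero>" "\<forall>x \<in> P. x \<otimes> a = \<zero>" "\<forall>y \<in> Q. y \<otimes> a = \<zero>"
      unfolding annihilating_sum_iff[OF ids] by blast
    obtain M where M: "M \<in> minimal_primes R" "a \<notin> M"
      using reduced_minimal_primes_avoid[OF red a(1,2)] .
    have "K \<subseteq> M" if "ideal K R" "\<forall>x \<in> K. x \<otimes> a = \<zero>" for K
    proof
      fix x assume x: "x \<in> K"
      have "x \<otimes> a \<in> M" using that(2) x ideal_zero_mem[OF minimal_primeD(1)[OF M(1)]] by simp
      then show "x \<in> M"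
        using minimal_primeD(3)[OF M(1)] ideal_carrier_mem[OF that(1) x] a(1) M(2) by blast
    qed
    then have "P \<subseteq> M" "Q \<subseteq> M" using a ids by auto
    then show False using minimal_primes_incomparable[OF M(1)] PQN by blast
  qed
  ultimately show ?thesis using vertex PQN by metis
qed

text \<open>A prime that avoids a nonzero annihilator of \<open>I\<close> contains \<open>I\<close>.\<close>

lemma reduced_two_minimal_primes_cases:
  assumes red: "reduced_ring R" and PQ: "minimal_primes R = {P, Q}"
    and I: "I \<in> nonzero_annihilating_ideals R"
  shows "I \<subseteq> P \<or> I \<subseteq> Q"
proof -
  obtain a where a: "a \<in> carrier R" "a \<noteq> \<zero>" "\<forall>x \<in> I. x \<otimes> a = \<zero>" and idI: "ideal I R"
    using I by (auto simp: vertex_iff)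
  obtain M where M: "M \<in> minimal_primes R" "a \<notin> M"
    using reduced_minimal_primes_avoid[OF red a(1,2)] .
  have "I \<subseteq> M"
  proof
    fix x assume x: "x \<in> I"
    have "x \<otimes> a \<in> M" using a(3) x ideal_zero_mem[OF minimal_primeD(1)[OF M(1)]] by simp
    then show "x \<in> M"
      using minimal_primeD(3)[OF M(1)] ideal_carrier_mem[OF idI x] a(1) M(2) by blast
  qed
  then show ?thesis using M(1) PQ by blast
qed

lemma reduced_two_minimal_primes_inter:
  assumes red: "reduced_ring R" and PQ: "minimal_primes R = {P, Q}"
  shows "P \<inter> Q \<subseteq> {\<zero>}"
proof
  fix x assume x: "x \<in> P \<inter> Q"
  have "ideal P R" using minimal_primeD(1) PQ by blast
  then have "x \<in> carrier R" using x ideal_carrier_mem by blast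
  then show "x \<in> {\<zero>}"
    using reduced_minimal_primes_avoid[OF red] x PQ by blast
qed

text \<open>Because \<open>P Q = \<zero>\<close>, ideals inside different primes annihilate each other, while any nonzero
  element of one prime annihilates every ideal inside the other.\<close>

lemma reduced_two_minimal_primes_sum:
  assumes red: "reduced_ring R" and PQ: "minimal_primes R = {P, Q}" "P \<noteq> Q"
    and I: "I \<in> nonzero_annihilating_ideals R" and J: "J \<in> nonzero_annihilating_ideals R"
  shows "I \<cdot> J = {\<zero>} \<or> annihilating_ideal R (I <+>\<^bsub>R\<^esub> J)"
proof -
  have ids: "ideal I R" "ideal J R" using I J by (auto simp: vertex_iff)
  have prod: "x \<otimes> y = \<zero>" if xy: "x \<in> M" "y \<in> N" and MN: "{M, N} = {P, Q}" for x y M N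
  proof -
    have "ideal M R" "ideal N R" using minimal_primeD(1) PQ(1) MN by (metis insertI1 insert_commute)+
    then have "x \<otimes> y \<in> M \<inter> N"
      using xy ideal.I_l_closed ideal.I_r_closed ideal_carrier_mem by (metis IntI)
    moreover have "M \<inter> N = P \<inter> Q" using MN by (metis doubleton_eq_iff inf_commute)
    ultimately show ?thesis
      using reduced_two_minimal_primes_inter[OF red PQ(1)] by blast
  qed
  have same: "annihilating_ideal R (I <+>\<^bsub>R\<^esub> J)"
    if sub: "I \<subseteq> M" "J \<subseteq> M" and MN: "{M, N} = {P, Q}" for M N
  proof -
    have MN': "M \<in> minimal_primes R" "N \<in> minimal_primes R" "M \<noteq> N"
      using MN PQ by (metis insertI1 insert_commute, metis insertI1 insert_commute, 
        metis doubleton_eq_iff)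
    have "ideal N R" using minimal_primeD(1)[OF MN'(2)] .
    moreover have "N \<noteq> {\<zero>}"
      using minimal_primes_incomparable[OF MN'(1,2)] MN'(3)
        ideal_zero_mem[OF minimal_primeD(1)[OF MN'(1)]] by blast
    ultimately obtain a where a: "a \<in> N" "a \<noteq> \<zero>" "a \<in> carrier R"
      using ideal_nonzero_obtain ideal_carrier_mem by metis
    then show ?thesis
      unfolding annihilating_sum_iff[OF ids] using prod[OF _ _ MN] sub by blast
  qed
  have diff: "I \<cdot> J = {\<zero>}" if "I \<subseteq> M" "J \<subseteq> N" "{M, N} = {P, Q}" for M N
    using prod[OF _ _ that(3)] that(1,2) ideal_prod_eq_zero_iff[OF ids] by blast
  have swap: "{Q, P} = {P, Q}" by blast
  have "I \<subseteq> P \<or> I \<subseteq> Q" "J \<subseteq> P \<or> J \<subseteq> Q"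
    using reduced_two_minimal_primes_cases[OF red PQ(1)] I J by auto
  then show ?thesis
  proof (elim disjE)
    show ?thesis if "I \<subseteq> P" "J \<subseteq> P" by (rule disjI2[OF same[OF that refl]])
    show ?thesis if "I \<subseteq> Q" "J \<subseteq> Q" by (rule disjI2[OF same[OF that swap]])
    show ?thesis if "I \<subseteq> P" "J \<subseteq> Q" by (rule disjI1[OF diff[OF that refl]])
    show ?thesis if "I \<subseteq> Q" "J \<subseteq> P" by (rule disjI1[OF diff[OF that swap]])
  qed
qed

text \<open>Nonzero ideals inside the same minimal prime never multiply to zero: one of them would lie
  in the other prime as well, hence in the zero intersection.\<close>

lemma reduced_three_vertices:
  assumes red: "reduced_ring R" and PQ: "minimal_primes R = {P, Q}"
    and S: "S \<subseteq> nonzero_annihilating_ideals R" "card S = 3"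
  shows "\<exists>I \<in> S. \<exists>J \<in> S. I \<noteq> J \<and> I \<cdot> J \<noteq> {\<zero>}"
proof -
  have nonzero: "I \<cdot> J \<noteq> {\<zero>}"
    if I: "I \<in> nonzero_annihilating_ideals R" and J: "J \<in> nonzero_annihilating_ideals R"
      and sub: "I \<subseteq> M" "J \<subseteq> M" and M: "{M, N} = {P, Q}" for I J M N
  proof
    assume 0: "I \<cdot> J = {\<zero>}"
    have ids: "ideal I R" "ideal J R" using I J by (auto simp: vertex_iff)
    have meet: "M \<inter> N \<subseteq> {\<zero>}"
      using reduced_two_minimal_primes_inter[OF red] M PQ by simp
    have N: "N \<in> minimal_primes R" unfolding PQ M[symmetric] by simp
    obtain x where x: "x \<in> I" "x \<noteq> \<zero>"
      using ideal_nonzero_obtain[OF ids(1)] I by (auto simp: vertex_iff)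
    obtain y where y: "y \<in> J" "y \<noteq> \<zero>"
      using ideal_nonzero_obtain[OF ids(2)] J by (auto simp: vertex_iff)
    have "x \<otimes> y \<in> N"
      using 0 x y ideal_prod_eq_zero_iff[OF ids] ideal_zero_mem[OF minimal_primeD(1)[OF N]] by simp
    then have "x \<in> N \<or> y \<in> N"
      using minimal_primeD(3)[OF N] x y ids ideal_carrier_mem by blast
    then show False using meet x y sub by blast
  qed
  obtain A B C where ABC: "S = {A, B, C}" "A \<noteq> B" "A \<noteq> C" "B \<noteq> C"
    using S(2) by (auto simp: card_3_iff)
  have V: "A \<in> nonzero_annihilating_ideals R" "B \<in> nonzero_annihilating_ideals R"
    "C \<in> nonzero_annihilating_ideals R" using S(1) ABC(1) by auto
  have swap: "{Q, P} = {P, Q}" by blast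
  have pair: "I \<cdot> J \<noteq> {\<zero>}"
    if "I \<in> nonzero_annihilating_ideals R" "J \<in> nonzero_annihilating_ideals R"
      "I \<subseteq> P \<and> J \<subseteq> P \<or> I \<subseteq> Q \<and> J \<subseteq> Q" for I J
    using that(3) nonzero[OF that(1,2) _ _ refl] nonzero[OF that(1,2) _ _ swap] by metis
  \<comment> \<open>Two of the three vertices lie in the same minimal prime.\<close>
  have "A \<subseteq> P \<or> A \<subseteq> Q" "B \<subseteq> P \<or> B \<subseteq> Q" "C \<subseteq> P \<or> C \<subseteq> Q"
    using reduced_two_minimal_primes_cases[OF red PQ] V by auto
  then consider "A \<subseteq> P \<and> B \<subseteq> P \<or> A \<subseteq> Q \<and> B \<subseteq> Q" | "A \<subseteq> P \<and> C \<subseteq> P \<or> A \<subseteq> Q \<and> C \<subseteq> Q"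
    | "B \<subseteq> P \<and> C \<subseteq> P \<or> B \<subseteq> Q \<and> C \<subseteq> Q"
    by argo
  then show ?thesis
  proof cases
    case 1
    then show ?thesis using pair[OF V(1,2)] ABC by blast
  next
    case 2
    then show ?thesis using pair[OF V(1,3)] ABC by blast
  next
    case 3
    then show ?thesis using pair[OF V(2,3)] ABC by blast
  qed
qed

section \<open>Products of two fields\<close>

text \<open>An idempotent \<open>e\<close> whose ideal, viewed as a ring with identity \<open>e\<close>, is a field. Two such
  idempotents that are orthogonal and add up to one express that the ring is a product of two
  fields, without leaving the ring.\<close>

definition corner_field :: "'a \<Rightarrow> bool" where
  "corner_field e \<longleftrightarrow> e \<in> carrier R \<and> e \<noteq> \<zero> \<and> e \<otimes> e = e \<and>
     (\<forall>t \<in> carrier R. t \<otimes> e = \<zero> \<or> (\<exists>s \<in> carrier R. s \<otimes> (t \<otimes> e) = e))"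

definition corner_ring :: "'a \<Rightarrow> 'a ring" where
  "corner_ring e = \<lparr>carrier = PIdl e, monoid.mult = (\<otimes>), one = e, ring.zero = \<zero>, ring.add = (\<oplus>)\<rparr>"

lemma corner_mult:
  assumes "e \<in> carrier R" "e \<otimes> e = e" "x \<in> PIdl e"
  shows "e \<otimes> x = x" "x \<otimes> e = x" "x \<in> carrier R"
proof -
  obtain r where r: "r \<in> carrier R" "x = r \<otimes> e" using assms(3) by (auto simp: PIdl_mem_iff)
  show xe: "x \<otimes> e = x" and xc: "x \<in> carrier R" using r assms by (simp_all add: m_assoc)
  show "e \<otimes> x = x" using m_comm[OF assms(1) xc] xe by simp
qed

lemma corner_field_field:
  assumes "corner_field e"
  shows "field (corner_ring e)"
proof -
  have e: "e \<in> carrier R" "e \<noteq> \<zero>" "e \<otimes> e = e"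
    and inv: "\<And>t. t \<in> carrier R \<Longrightarrow> t \<otimes> e = \<zero> \<or> (\<exists>s \<in> carrier R. s \<otimes> (t \<otimes> e) = e)"
    using assms by (auto simp: corner_field_def)
  note idl = cgenideal_ideal[OF e(1)]
  note C = corner_mult[OF e(1,3)]
  have eP: "e \<in> PIdl e" by (rule cgenideal_self[OF e(1)])
  have neg: "\<ominus> x \<in> PIdl e" if "x \<in> PIdl e" for x
    using that idl by (simp add: additive_subgroup.a_inv_closed ideal.axioms(1))
  have "cring (corner_ring e)"
  proof (rule cringI)
    show "abelian_group (corner_ring e)"
    proof (rule abelian_groupI)
      show "\<exists>y \<in> carrier (corner_ring e).
          y \<oplus>\<^bsub>corner_ring e\<^esub> x = \<zero>\<^bsub>corner_ring e\<^esub>" if "x \<in> carrier (corner_ring e)" for x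
        using that neg[of x] C(3)[of x]
        by (intro bexI[of _ "\<ominus> x"]) (simp_all add: corner_ring_def l_neg)
    qed (auto simp: corner_ring_def ideal_add_mem[OF idl] ideal_zero_mem[OF idl] C a_assoc intro: a_comm)
    show "Group.comm_monoid (corner_ring e)"
      by (rule comm_monoidI)
        (auto simp: corner_ring_def eP C m_assoc intro: ideal.I_l_closed[OF idl] m_comm)
  qed (auto simp: corner_ring_def C l_distr)
  then show ?thesis
  proof (rule cring.cring_fieldI)
    interpret K: cring "corner_ring e" by fact
    show "Units (corner_ring e) = carrier (corner_ring e) - {\<zero>\<^bsub>corner_ring e\<^esub>}"
    proof (intro equalityI subsetI)
      fix x assume "x \<in> Units (corner_ring e)"
      then obtain y where y: "x \<in> PIdl e" "y \<in> PIdl e" "y \<otimes> x = e"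
        by (auto simp: Units_def corner_ring_def)
      have "x \<noteq> \<zero>"
        using y(3) e(2) r_null[OF C(3)[OF y(2)]] by metis
      then show "x \<in> carrier (corner_ring e) - {\<zero>\<^bsub>corner_ring e\<^esub>}"
        using y(1) by (simp add: corner_ring_def)
    next
      fix x assume "x \<in> carrier (corner_ring e) - {\<zero>\<^bsub>corner_ring e\<^esub>}"
      then have x: "x \<in> PIdl e" "x \<noteq> \<zero>" by (auto simp: corner_ring_def)
      then obtain s where s: "s \<in> carrier R" "s \<otimes> x = e"
        using inv[of x] C[of x] by auto
      have se: "s \<otimes> e \<in> PIdl e" using s PIdl_mem_iff by blast
      have 1: "(s \<otimes> e) \<otimes> x = e" using s e C[OF x(1)] by (simp add: m_assoc)
      then have "x \<otimes> (s \<otimes> e) = e" using m_comm[OF C(3)[OF x(1)] C(3)[OF se]] by simp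
      then show "x \<in> Units (corner_ring e)"
        using 1 x se unfolding Units_def corner_ring_def by auto
    qed
  qed
qed

text \<open>The Peirce decomposition with respect to two complementary orthogonal idempotents; the
  inverse map is addition of the two components.\<close>

lemma ring_iso_corners:
  assumes e: "e \<in> carrier R" "e \<otimes> e = e" and f: "f \<in> carrier R" "f \<otimes> f = f"
    and ef: "e \<otimes> f = \<zero>" "e \<oplus> f = \<one>"
  shows "(\<lambda>x. (x \<otimes> e, x \<otimes> f)) \<in> ring_iso R (RDirProd (corner_ring e) (corner_ring f))"
proof (rule ring_iso_memI)
  let ?D = "RDirProd (corner_ring e) (corner_ring f)"
  have fe: "f \<otimes> e = \<zero>" using ef(1) m_comm[OF e(1) f(1)] by simp
  have split: "x = x \<otimes> e \<oplus> x \<otimes> f" if "x \<in> carrier R" for x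
    using that e f ef(2) r_distr[of e f x] by simp
  have mult: "(x \<otimes> y) \<otimes> g = (x \<otimes> g) \<otimes> (y \<otimes> g)"
    if "x \<in> carrier R" "y \<in> carrier R" "g \<in> carrier R" "g \<otimes> g = g" for x y g
  proof -
    have "(x \<otimes> g) \<otimes> (y \<otimes> g) = (x \<otimes> y) \<otimes> (g \<otimes> g)"
      using that(1-3) by (simp add: m_assoc m_lcomm)
    then show ?thesis using that(4) by simp
  qed
  show "(x \<otimes> e, x \<otimes> f) \<in> carrier ?D" if "x \<in> carrier R" for x
    using that by (auto simp: RDirProd_carrier corner_ring_def PIdl_mem_iff)
  show "((x \<otimes> y) \<otimes> e, (x \<otimes> y) \<otimes> f) = (x \<otimes> e, x \<otimes> f) \<otimes>\<^bsub>?D\<^esub> (y \<otimes> e, y \<otimes> f)"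
    if "x \<in> carrier R" "y \<in> carrier R" for x y
    using mult[OF that e] mult[OF that f]
    by (simp add: RDirProd_def DirProd_def monoid.defs corner_ring_def)
  show "((x \<oplus> y) \<otimes> e, (x \<oplus> y) \<otimes> f) = (x \<otimes> e, x \<otimes> f) \<oplus>\<^bsub>?D\<^esub> (y \<otimes> e, y \<otimes> f)"
    if "x \<in> carrier R" "y \<in> carrier R" for x y
    using that e f by (simp add: RDirProd_def DirProd_def monoid.defs corner_ring_def l_distr)
  show "(\<one> \<otimes> e, \<one> \<otimes> f) = \<one>\<^bsub>?D\<^esub>"
    using e f by (simp add: RDirProd_def DirProd_def monoid.defs corner_ring_def)
  show "bij_betw (\<lambda>x. (x \<otimes> e, x \<otimes> f)) (carrier R) (carrier ?D)"
    unfolding bij_betw_def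
  proof
    show "inj_on (\<lambda>x. (x \<otimes> e, x \<otimes> f)) (carrier R)"
    proof (rule inj_onI)
      fix x y assume xy: "x \<in> carrier R" "y \<in> carrier R" "(x \<otimes> e, x \<otimes> f) = (y \<otimes> e, y \<otimes> f)"
      have "x = x \<otimes> e \<oplus> x \<otimes> f" by (rule split[OF xy(1)])
      also have "\<dots> = y \<otimes> e \<oplus> y \<otimes> f" using xy(3) by simp
      also have "\<dots> = y" by (rule split[OF xy(2), symmetric])
      finally show "x = y" .
    qed
    show "(\<lambda>x. (x \<otimes> e, x \<otimes> f)) ` carrier R = carrier ?D"
    proof (intro equalityI subsetI)
      fix p assume "p \<in> carrier ?D"
      then obtain a b where p: "p = (a, b)" and a: "a \<in> PIdl e" and b: "b \<in> PIdl f"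
        by (auto simp: RDirProd_carrier corner_ring_def)
      note A = corner_mult[OF e a] and B = corner_mult[OF f b]
      have "a \<otimes> f = \<zero>"
        using m_assoc[OF A(3) e(1) f(1)] A ef by simp
      moreover have "b \<otimes> e = \<zero>"
        using m_assoc[OF B(3) f(1) e(1)] B fe by simp
      ultimately have "p = ((a \<oplus> b) \<otimes> e, (a \<oplus> b) \<otimes> f)"
        using p A B e f by (simp add: l_distr)
      then show "p \<in> (\<lambda>x. (x \<otimes> e, x \<otimes> f)) ` carrier R"
        using A(3) B(3) by blast
    qed (auto simp: RDirProd_carrier corner_ring_def PIdl_mem_iff)
  qed
qed

text \<open>A surjection of \<open>R\<close> onto a field whose kernel is annihilated by \<open>e\<close>, and which maps \<open>e\<close>
  to one, identifies the ideal of \<open>e\<close> with that field.\<close>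

lemma corner_field_if_hom_onto_field:
  fixes F :: "('c, 'd) ring_scheme"
  assumes F: "field F" and hom: "\<phi> \<in> ring_hom R F" and onto: "\<phi> ` carrier R = carrier F"
    and e: "e \<in> carrier R" "\<phi> e = \<one>\<^bsub>F\<^esub>"
    and ker: "\<And>t. t \<in> carrier R \<Longrightarrow> \<phi> t = \<zero>\<^bsub>F\<^esub> \<Longrightarrow> t \<otimes> e = \<zero>"
  shows "corner_field e"
proof -
  interpret F: field F by fact
  interpret \<phi>: ring_hom_ring R F \<phi>
    by (rule ring_hom_ringI2[OF ring_axioms F.ring_axioms hom])
  have fix_e: "r \<otimes> e = e" if r: "r \<in> carrier R" "\<phi> r = \<one>\<^bsub>F\<^esub>" for r
  proof -
    have "\<phi> (r \<ominus> \<one>) = \<zero>\<^bsub>F\<^esub>"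
      using r by (simp add: minus_eq F.r_neg)
    then have "(r \<ominus> \<one>) \<otimes> e = \<zero>" using ker r(1) by simp
    moreover have "(r \<ominus> \<one>) \<otimes> e = r \<otimes> e \<ominus> e" using r(1) e(1) by algebra
    ultimately show ?thesis using r(1) e(1) by (simp add: r_right_minus_eq)
  qed
  show ?thesis
    unfolding corner_field_def
  proof (intro conjI ballI)
    show "e \<in> carrier R" by fact
    show "e \<noteq> \<zero>" using e(2) \<phi>.hom_zero F.one_not_zero by metis
    show "e \<otimes> e = e" by (rule fix_e[OF e])
    fix t assume t: "t \<in> carrier R"
    show "t \<otimes> e = \<zero> \<or> (\<exists>s \<in> carrier R. s \<otimes> (t \<otimes> e) = e)"
    proof (cases "\<phi> t = \<zero>\<^bsub>F\<^esub>")
      case True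
      then show ?thesis using ker[OF t] by simp
    next
      case False
      then have "\<phi> t \<in> Units F" using F.field_Units \<phi>.hom_closed[OF t] by blast
      then obtain c where c: "c \<in> carrier F" "c \<otimes>\<^bsub>F\<^esub> \<phi> t = \<one>\<^bsub>F\<^esub>"
        by (auto simp: Units_def)
      then obtain s where s: "s \<in> carrier R" "\<phi> s = c" using onto by (metis imageE)
      have "(s \<otimes> t) \<otimes> e = e" using s t c by (intro fix_e) simp_all
      then show ?thesis using s(1) t e(1) by (auto simp: m_assoc)
    qed
  qed
qed

lemma corner_fields_if_iso:
  fixes F\<^sub>1 :: "('c, 'd) ring_scheme" and F\<^sub>2 :: "('e, 'f) ring_scheme"
  assumes "field F\<^sub>1" "field F\<^sub>2" "R \<simeq> RDirProd F\<^sub>1 F\<^sub>2"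
  shows "\<exists>e f. corner_field e \<and> corner_field f \<and> e \<otimes> f = \<zero> \<and> e \<oplus> f = \<one>"
proof -
  interpret F1: field F\<^sub>1 by fact
  interpret F2: field F\<^sub>2 by fact
  let ?D = "RDirProd F\<^sub>1 F\<^sub>2"
  have D: "ring ?D" by (intro RDirProd_ring F1.ring_axioms F2.ring_axioms)
  obtain h where h: "h \<in> ring_iso R ?D"
    using assms(3) by (auto simp: is_ring_iso_def)
  then have hom: "h \<in> ring_hom R ?D" and bij: "bij_betw h (carrier R) (carrier ?D)"
    by (auto simp: ring_iso_def)
  have inj: "x = y" if "h x = h y" "x \<in> carrier R" "y \<in> carrier R" for x y
    using bij that by (auto simp: bij_betw_def inj_on_def)
  have surj: "\<exists>x \<in> carrier R. h x = (a, b)" if "a \<in> carrier F\<^sub>1" "b \<in> carrier F\<^sub>2" for a b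
  proof -
    have "(a, b) \<in> h ` carrier R"
      using bij that by (simp add: bij_betw_def RDirProd_carrier)
    then show ?thesis by force
  qed
  have hc: "fst (h x) \<in> carrier F\<^sub>1" "snd (h x) \<in> carrier F\<^sub>2" if "x \<in> carrier R" for x
    using ring_hom_closed[OF hom that] by (auto simp: RDirProd_carrier)
  have h0: "h \<zero> = (\<zero>\<^bsub>F\<^sub>1\<^esub>, \<zero>\<^bsub>F\<^sub>2\<^esub>)"
    using ring_hom_zero[OF hom ring_axioms D] by (simp add: RDirProd_def DirProd_def monoid.defs)
  have h1: "h \<one> = (\<one>\<^bsub>F\<^sub>1\<^esub>, \<one>\<^bsub>F\<^sub>2\<^esub>)"
    using ring_hom_one[OF hom] by (simp add: RDirProd_def DirProd_def monoid.defs)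
  have hm: "h (x \<otimes> y) = (fst (h x) \<otimes>\<^bsub>F\<^sub>1\<^esub> fst (h y), snd (h x) \<otimes>\<^bsub>F\<^sub>2\<^esub> snd (h y))"
    if "x \<in> carrier R" "y \<in> carrier R" for x y
    using ring_hom_mult[OF hom that]
    by (simp add: RDirProd_def DirProd_def monoid.defs split: prod.splits)
  have ha: "h (x \<oplus> y) = (fst (h x) \<oplus>\<^bsub>F\<^sub>1\<^esub> fst (h y), snd (h x) \<oplus>\<^bsub>F\<^sub>2\<^esub> snd (h y))"
    if "x \<in> carrier R" "y \<in> carrier R" for x y
    using ring_hom_add[OF hom that]
    by (simp add: RDirProd_def DirProd_def monoid.defs split: prod.splits)
  obtain e where e: "e \<in> carrier R" "h e = (\<one>\<^bsub>F\<^sub>1\<^esub>, \<zero>\<^bsub>F\<^sub>2\<^esub>)"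
    using surj[of "\<one>\<^bsub>F\<^sub>1\<^esub>" "\<zero>\<^bsub>F\<^sub>2\<^esub>"] by auto
  obtain f where f: "f \<in> carrier R" "h f = (\<zero>\<^bsub>F\<^sub>1\<^esub>, \<one>\<^bsub>F\<^sub>2\<^esub>)"
    using surj[of "\<zero>\<^bsub>F\<^sub>1\<^esub>" "\<one>\<^bsub>F\<^sub>2\<^esub>"] by auto
  have "e \<otimes> f = \<zero>"
    using e f by (intro inj) (simp_all add: hm h0)
  moreover have "e \<oplus> f = \<one>"
    using e f by (intro inj) (simp_all add: ha h1)
  moreover have "corner_field e"
  proof (rule corner_field_if_hom_onto_field[OF assms(1), of "\<lambda>x. fst (h x)"])
    show "(\<lambda>x. fst (h x)) \<in> ring_hom R F\<^sub>1"
      by (rule ring_hom_memI) (simp_all add: hc hm ha h1)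
    show "(\<lambda>x. fst (h x)) ` carrier R = carrier F\<^sub>1"
      using hc(1) surj[OF _ F2.zero_closed] by (force simp: image_iff)
    show "t \<otimes> e = \<zero>" if "t \<in> carrier R" "fst (h t) = \<zero>\<^bsub>F\<^sub>1\<^esub>" for t
      using that e hc by (intro inj) (simp_all add: hm h0)
  qed (use e in simp_all)
  moreover have "corner_field f"
  proof (rule corner_field_if_hom_onto_field[OF assms(2), of "\<lambda>x. snd (h x)"])
    show "(\<lambda>x. snd (h x)) \<in> ring_hom R F\<^sub>2"
      by (rule ring_hom_memI) (simp_all add: hc hm ha h1)
    show "(\<lambda>x. snd (h x)) ` carrier R = carrier F\<^sub>2"
      using hc(2) surj[OF F1.zero_closed] by (force simp: image_iff)
    show "t \<otimes> f = \<zero>" if "t \<in> carrier R" "snd (h t) = \<zero>\<^bsub>F\<^sub>2\<^esub>" for t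
      using that f hc by (intro inj) (simp_all add: hm h0)
  qed (use f in simp_all)
  ultimately show ?thesis by blast
qed

lemma product_of_two_fields_iff:
  "(\<exists>(F\<^sub>1 :: 'a ring) (F\<^sub>2 :: 'a ring). field F\<^sub>1 \<and> field F\<^sub>2 \<and> R \<simeq> RDirProd F\<^sub>1 F\<^sub>2) \<longleftrightarrow>
     (\<exists>e f. corner_field e \<and> corner_field f \<and> e \<otimes> f = \<zero> \<and> e \<oplus> f = \<one>)"
proof
  assume "\<exists>(F\<^sub>1 :: 'a ring) (F\<^sub>2 :: 'a ring). field F\<^sub>1 \<and> field F\<^sub>2 \<and> R \<simeq> RDirProd F\<^sub>1 F\<^sub>2"
  then show "\<exists>e f. corner_field e \<and> corner_field f \<and> e \<otimes> f = \<zero> \<and> e \<oplus> f = \<one>"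
    using corner_fields_if_iso by blast
next
  assume "\<exists>e f. corner_field e \<and> corner_field f \<and> e \<otimes> f = \<zero> \<and> e \<oplus> f = \<one>"
  then obtain e f where ef: "corner_field e" "corner_field f" "e \<otimes> f = \<zero>" "e \<oplus> f = \<one>" by blast
  then have "R \<simeq> RDirProd (corner_ring e) (corner_ring f)"
    unfolding is_ring_iso_def using ring_iso_corners[of e f] unfolding corner_field_def by auto
  then show "\<exists>(F\<^sub>1 :: 'a ring) (F\<^sub>2 :: 'a ring). field F\<^sub>1 \<and> field F\<^sub>2 \<and> R \<simeq> RDirProd F\<^sub>1 F\<^sub>2"
    using corner_field_field ef(1,2) by blast
qed

text \<open>A nonzero ideal has a nonzero component in one of the two corners and therefore contains the
  corresponding idempotent. A proper ideal cannot contain both, so it is exactly one corner.\<close>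

lemma corner_fields_vertices:
  assumes e: "corner_field e" and f: "corner_field f" and ef: "e \<otimes> f = \<zero>" "e \<oplus> f = \<one>"
  shows "nonzero_annihilating_ideals R = {PIdl e, PIdl f}" and "PIdl e \<noteq> PIdl f"
    and "(PIdl e) \<cdot> (PIdl f) = {\<zero>}"
proof -
  have ec: "e \<in> carrier R" "e \<noteq> \<zero>" "e \<otimes> e = e" and fc: "f \<in> carrier R" "f \<noteq> \<zero>" "f \<otimes> f = f"
    using e f by (auto simp: corner_field_def)
  have fe: "f \<otimes> e = \<zero>" using ef(1) m_comm[OF ec(1) fc(1)] by simp
  have fe1: "f \<oplus> e = \<one>" using ef(2) a_comm[OF ec(1) fc(1)] by simp
  have idl: "ideal (PIdl e) R" "ideal (PIdl f) R" using ec fc cgenideal_ideal by auto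
  have "x \<otimes> y = \<zero>" if "x \<in> PIdl e" "y \<in> PIdl f" for x y
    using mult_PIdl_zero[OF ec(1) fc(1) ef(1) that(2)]
      mult_PIdl_zero[OF _ ec(1) _ that(1), of y] corner_mult(3)[OF fc(1,3) that(2)] by blast
  then show prod: "(PIdl e) \<cdot> (PIdl f) = {\<zero>}"
    using ideal_prod_eq_zero_iff[OF idl] by blast
  show "PIdl e \<noteq> PIdl f"
  proof
    assume "PIdl e = PIdl f"
    then have "f \<in> PIdl e" using cgenideal_self fc(1) by blast
    then show False using corner_mult(1)[OF ec(1,3)] ef(1) fc(2) by metis
  qed
  have contains: "I = PIdl g"
    if I: "I \<in> nonzero_annihilating_ideals R" and g: "corner_field g" and k: "corner_field k"
      and gk: "g \<oplus> k = \<one>" and x: "x \<in> I" "x \<otimes> g \<noteq> \<zero>" for I g k x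
  proof -
    have idI: "ideal I R" using I by (simp add: vertex_iff)
    have gc: "g \<in> carrier R" "k \<in> carrier R" using g k by (auto simp: corner_field_def)
    have hit: "h \<in> I" if h: "corner_field h" and y: "y \<in> I" "y \<otimes> h \<noteq> \<zero>" for h y
    proof -
      have yc: "y \<in> carrier R" and hc: "h \<in> carrier R"
        using y ideal_carrier_mem[OF idI] h by (auto simp: corner_field_def)
      then obtain s where s: "s \<in> carrier R" "s \<otimes> (y \<otimes> h) = h"
        using h y(2) unfolding corner_field_def by blast
      have "s \<otimes> (y \<otimes> h) \<in> I"
        using ideal.I_l_closed[OF idI ideal.I_r_closed[OF idI y(1) hc] s(1)] .
      then show ?thesis using s(2) by simp
    qed
    have gI: "g \<in> I" using hit[OF g x] .
    have kI: "k \<notin> I"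
      using ideal_add_mem[OF idI gI, of k] gk vertex_proper[OF I] by auto
    show ?thesis
    proof
      show "PIdl g \<subseteq> I" by (rule cgenideal_minimal[OF idI gI])
      show "I \<subseteq> PIdl g"
      proof
        fix y assume y: "y \<in> I"
        then have yc: "y \<in> carrier R" using ideal_carrier_mem[OF idI] by blast
        have "y \<otimes> k = \<zero>" using hit[OF k y] kI by blast
        then have "y = y \<otimes> g"
          using r_distr[OF gc yc] gk yc gc by simp
        then show "y \<in> PIdl g" using yc PIdl_mem_iff by blast
      qed
    qed
  qed
  have "I \<in> {PIdl e, PIdl f}" if I: "I \<in> nonzero_annihilating_ideals R" for I
  proof -
    obtain x where x: "x \<in> I" "x \<noteq> \<zero>" "x \<in> carrier R"
      using I ideal_nonzero_obtain ideal_carrier_mem unfolding vertex_iff by metis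
    have "x = x \<otimes> e \<oplus> x \<otimes> f"
      using r_distr[OF ec(1) fc(1) x(3)] ef(2) x(3) by simp
    then have "x \<otimes> e \<noteq> \<zero> \<or> x \<otimes> f \<noteq> \<zero>" using x by auto
    then show ?thesis
      using contains[OF I e f ef(2) x(1)] contains[OF I f e fe1 x(1)] by blast
  qed
  moreover have "e \<in> zero_divisors R" "f \<in> zero_divisors R"
    using ec fc ef(1) fe by (auto simp: zero_divisors_def)
  then have "PIdl e \<in> nonzero_annihilating_ideals R" "PIdl f \<in> nonzero_annihilating_ideals R"
    using PIdl_vertex ec fc by auto
  ultimately show "nonzero_annihilating_ideals R = {PIdl e, PIdl f}" by blast
qed

section \<open>Complete annihilating-ideal graphs\<close>

text \<open>The geometric series \<open>\<one> + w + w\<^sup>2\<close> inverts \<open>\<one> - w\<close> when \<open>w\<^sup>3 = \<zero>\<close>.\<close>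

lemma unit_if_nilpotent_difference:
  assumes "u \<in> carrier R" "w \<in> carrier R" "w = \<one> \<ominus> u" "w \<otimes> w \<otimes> w = \<zero>"
  shows "\<exists>v \<in> carrier R. v \<otimes> u = \<one>"
proof
  let ?v = "\<one> \<oplus> w \<oplus> w \<otimes> w"
  have u: "u = \<one> \<ominus> w" using assms(1-3) by algebra
  have "?v \<otimes> u = \<one> \<ominus> w \<otimes> w \<otimes> w" unfolding u using assms(2) by algebra
  then show "?v \<otimes> u = \<one>" using assms(4) by (simp add: minus_eq)
  show "?v \<in> carrier R" using assms(2) by simp
qed

lemma one_minus_zero_divisor:
  assumes "r \<in> carrier R" "x \<in> carrier R" "x \<noteq> \<zero>" "x = r \<otimes> x"
  shows "\<one> \<ominus> r \<in> zero_divisors R"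
proof -
  have "(\<one> \<ominus> r) \<otimes> x = x \<ominus> r \<otimes> x" using assms(1,2) by algebra
  also have "\<dots> = \<zero>" using assms(1,2) assms(4)[symmetric] by (simp add: r_right_minus_eq)
  finally show ?thesis using assms by (auto simp: zero_divisors_def)
qed

lemma zero_divisors_eq_Union:
  assumes "nonzero_annihilating_ideals R \<noteq> {}"
  shows "zero_divisors R = \<Union>(nonzero_annihilating_ideals R)"
proof (intro equalityI subsetI)
  fix x assume x: "x \<in> zero_divisors R"
  then have xc: "x \<in> carrier R" by (simp add: zero_divisors_def)
  show "x \<in> \<Union>(nonzero_annihilating_ideals R)"
  proof (cases "x = \<zero>")
    case True
    then show ?thesis using assms ideal_zero_mem by (auto simp: vertex_iff)
  next
    case False
    then show ?thesis using PIdl_vertex[OF x] cgenideal_self[OF xc] by blast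
  qed
qed (use vertex_subset_zero_divisors in blast)

lemma one_neq_zero_if_vertex:
  assumes "nonzero_annihilating_ideals R \<noteq> {}"
  shows "\<one> \<noteq> \<zero>"
proof -
  obtain I where I: "I \<in> nonzero_annihilating_ideals R" using assms by blast
  then have "ideal I R" by (simp add: vertex_iff)
  then show ?thesis using vertex_proper[OF I] ideal_zero_mem by metis
qed

lemma zero_divisorsI:
  "\<lbrakk>x \<in> carrier R; y \<in> carrier R; y \<noteq> \<zero>; x \<otimes> y = \<zero>\<rbrakk> \<Longrightarrow> x \<in> zero_divisors R"
  unfolding zero_divisors_def by blast

text \<open>In a nonzero ring, addition is the only closure property of an ideal that can fail.\<close>

lemma zero_divisors_idealI:
  assumes one: "\<one> \<noteq> \<zero>"
    and add: "\<And>x y. x \<in> zero_divisors R \<Longrightarrow> y \<in> zero_divisors R \<Longrightarrow> x \<oplus> y \<in> zero_divisors R"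
  shows "ideal (zero_divisors R) R"
proof (rule idealI[OF ring_axioms])
  let ?Z = "zero_divisors R"
  have Zc: "x \<in> carrier R" if "x \<in> ?Z" for x using that by (simp add: zero_divisors_def)
  show mult: "r \<otimes> x \<in> ?Z" if x: "x \<in> ?Z" and r: "r \<in> carrier R" for x r
    using annihilating_subset_zero_divisors[OF PIdl_annihilating[OF x]] r PIdl_mem_iff by blast
  show "x \<otimes> r \<in> ?Z" if "x \<in> ?Z" "r \<in> carrier R" for x r
    using mult[OF that] m_comm[OF Zc[OF that(1)] that(2)] by simp
  show "subgroup ?Z (add_monoid R)"
  proof (rule add.subgroupI)
    show "?Z \<subseteq> carrier R" using Zc by blast
    have "\<zero> \<in> ?Z" by (rule zero_divisorsI[OF _ one_closed one]) simp_all
    then show "?Z \<noteq> {}" by blast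
    show "\<ominus> x \<in> ?Z" if "x \<in> ?Z" for x
      using mult[OF that, of "\<ominus> \<one>"] Zc[OF that] by (simp add: l_minus)
  qed (rule add)
qed

text \<open>If there is one vertex only, it is a minimal ideal, it contains all zero divisors, and it equals
  its own annihilator. Regular elements turn out to be invertible, so no other proper ideals
  remain.\<close>

lemma one_vertex_iff:
  assumes ne: "nonzero_annihilating_ideals R \<noteq> {}"
  shows "(\<forall>I \<in> nonzero_annihilating_ideals R. \<forall>J \<in> nonzero_annihilating_ideals R. I = J) \<longleftrightarrow>
    nonzero_proper_ideals R = {zero_divisors R}"
proof
  assume "nonzero_proper_ideals R = {zero_divisors R}"
  then show "\<forall>I \<in> nonzero_annihilating_ideals R. \<forall>J \<in> nonzero_annihilating_ideals R. I = J"
    using vertices_subset_proper_ideals by (metis singletonD subsetD)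
next
  assume all: "\<forall>I \<in> nonzero_annihilating_ideals R. \<forall>J \<in> nonzero_annihilating_ideals R. I = J"
  let ?Z = "zero_divisors R"
  obtain I where I: "I \<in> nonzero_annihilating_ideals R" using ne by blast
  then have "nonzero_annihilating_ideals R = {I}" using all by blast
  then have Z: "?Z = I" using zero_divisors_eq_Union[OF ne] by simp
  then have ZV: "?Z \<in> nonzero_annihilating_ideals R" using I by simp
  then have idZ: "ideal ?Z R" "?Z \<noteq> {\<zero>}" by (auto simp: vertex_iff)
  have "?Z \<cdot> ?Z = {\<zero>}"
    using ann_vertex[OF ZV] all ZV by metis
  then have sq: "w \<otimes> w = \<zero>" if "w \<in> ?Z" for w
    using ideal_prod_eq_zero_iff[OF idZ(1) idZ(1)] that by blast
  obtain x where x: "x \<in> ?Z" "x \<noteq> \<zero>" using ideal_nonzero_obtain[OF idZ] .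
  have xc: "x \<in> carrier R" using x ideal_carrier_mem idZ by blast
  have "J = ?Z" if J: "J \<in> nonzero_proper_ideals R" for J
  proof -
    have idJ: "ideal J R" "J \<noteq> {\<zero>}" "J \<noteq> carrier R" using J by (auto simp: nonzero_proper_ideals_def)
    have "J \<subseteq> ?Z"
    proof
      fix r assume r: "r \<in> J"
      then have rc: "r \<in> carrier R" using ideal_carrier_mem idJ by blast
      show "r \<in> ?Z"
      proof (rule ccontr)
        \<comment> \<open>Multiplication by a regular element cannot kill \<open>x\<close>, so it maps the minimal
          ideal onto itself, which makes the element invertible up to a nilpotent.\<close>
        assume nr: "r \<notin> ?Z"
        have "r \<otimes> x \<noteq> \<zero>" using nr rc xc x(2) by (auto simp: zero_divisors_def)
        moreover have "r \<otimes> x \<in> ?Z" using ideal.I_l_closed[OF idZ(1) x(1) rc] .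
        ultimately have "PIdl (r \<otimes> x) = PIdl x"
          using all PIdl_vertex x by blast
        then obtain s where s: "s \<in> carrier R" "x = s \<otimes> (r \<otimes> x)"
          using cgenideal_self[OF xc] PIdl_mem_iff by blast
        then have "x = (s \<otimes> r) \<otimes> x" using rc xc by (simp add: m_assoc)
        then have "\<one> \<ominus> s \<otimes> r \<in> ?Z"
          using one_minus_zero_divisor s rc xc x(2) by simp
        then obtain v where v: "v \<in> carrier R" "v \<otimes> (s \<otimes> r) = \<one>"
          using unit_if_nilpotent_difference[of "s \<otimes> r"] sq s rc by auto
        have "(v \<otimes> s) \<otimes> r \<in> J" using ideal.I_l_closed[OF idJ(1) r] v s by simp
        then have "\<one> \<in> J" using v s rc by (simp add: m_assoc)
        then show False using ideal.one_imp_carrier[OF idJ(1)] idJ(3) by blast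
      qed
    qed
    then have "J \<in> nonzero_annihilating_ideals R"
      using ZV idJ unfolding vertex_iff by blast
    then show ?thesis using all ZV by blast
  qed
  moreover have "?Z \<in> nonzero_proper_ideals R"
    using ZV vertices_subset_proper_ideals by blast
  ultimately show "nonzero_proper_ideals R = {?Z}" by blast
qed

definition pairwise_annihilating :: bool where
  "pairwise_annihilating \<longleftrightarrow>
     (\<forall>I \<in> nonzero_annihilating_ideals R. \<forall>J \<in> nonzero_annihilating_ideals R.
        I \<noteq> J \<longrightarrow> I \<cdot> J = {\<zero>})"

lemma pairwise_annihilatingD:
  assumes "pairwise_annihilating" "I \<in> nonzero_annihilating_ideals R"
    "J \<in> nonzero_annihilating_ideals R" "I \<noteq> J" "x \<in> I" "y \<in> J"
  shows "x \<otimes> y = \<zero>"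
proof -
  have "ideal I R" "ideal J R" using assms(2,3) by (auto simp: vertex_iff)
  moreover have "I \<cdot> J = {\<zero>}"
    using assms(1-4) by (auto simp: pairwise_annihilating_def)
  ultimately show ?thesis using ideal_prod_eq_zero_iff assms(5,6) by blast
qed

text \<open>Every nonzero ideal inside that of \<open>e\<close> is again a vertex and is not annihilated by \<open>e\<close>, so
  completeness forces it to be the whole ideal of \<open>e\<close>.\<close>

lemma pairwise_annihilating_corner_field:
  assumes pa: "pairwise_annihilating" and e: "e \<in> carrier R" "e \<otimes> e = e" "e \<noteq> \<zero>"
    and f: "f \<in> carrier R" "f \<noteq> \<zero>" "e \<otimes> f = \<zero>"
  shows "corner_field e"
  unfolding corner_field_def
proof (intro conjI ballI)
  fix t assume t: "t \<in> carrier R"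
  have te: "t \<otimes> e \<in> zero_divisors R" "e \<in> zero_divisors R"
    using t e f by (auto simp: zero_divisors_def m_assoc intro!: bexI[of _ f])
  show "t \<otimes> e = \<zero> \<or> (\<exists>s \<in> carrier R. s \<otimes> (t \<otimes> e) = e)"
  proof (cases "PIdl (t \<otimes> e) = PIdl e")
    case True
    then have "e \<in> PIdl (t \<otimes> e)" using cgenideal_self e(1) by blast
    then show ?thesis using PIdl_mem_iff by metis
  next
    case False
    have "t \<otimes> e = \<zero>"
    proof (rule ccontr)
      assume "t \<otimes> e \<noteq> \<zero>"
      then have "(t \<otimes> e) \<otimes> e = \<zero>"
        using pairwise_annihilatingD[OF pa PIdl_vertex[OF te(1)] PIdl_vertex[OF te(2) e(3)] False
            cgenideal_self cgenideal_self] t e(1) by simp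
      then show False using \<open>t \<otimes> e \<noteq> \<zero>\<close> t e by (simp add: m_assoc)
    qed
    then show ?thesis ..
  qed
qed (use e in auto)

text \<open>Either \<open>x\<close> and \<open>x\<^sup>2\<close> generate different vertices, which annihilate each other, or
  \<open>x = r x\<^sup>2\<close>; in the latter case \<open>r x\<close> is a nontrivial idempotent and splits the ring into two
  fields.\<close>

lemma pairwise_annihilating_cube_zero:
  assumes pa: "pairwise_annihilating" and x: "x \<in> zero_divisors R"
    and no_fields: "\<not> (\<exists>e f. corner_field e \<and> corner_field f \<and> e \<otimes> f = \<zero> \<and> e \<oplus> f = \<one>)"
  shows "x \<otimes> x \<otimes> x = \<zero>"
proof (cases "x \<otimes> x = \<zero>")
  case True
  then show ?thesis using x by (simp add: zero_divisors_def)
next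
  case False
  obtain y where xc: "x \<in> carrier R" and y: "y \<in> carrier R" "y \<noteq> \<zero>" "x \<otimes> y = \<zero>"
    using x by (auto simp: zero_divisors_def)
  have x0: "x \<noteq> \<zero>" using False xc by auto
  have "(x \<otimes> x) \<otimes> y = \<zero>" using xc y by (simp add: m_assoc)
  then have xx: "x \<otimes> x \<in> zero_divisors R" using xc y by (auto simp: zero_divisors_def)
  show ?thesis
  proof (cases "PIdl (x \<otimes> x) = PIdl x")
    case False
    then show ?thesis
      using pairwise_annihilatingD[OF pa PIdl_vertex[OF xx \<open>x \<otimes> x \<noteq> \<zero>\<close>] PIdl_vertex[OF x x0] False
          cgenideal_self cgenideal_self] xc by simp
  next
    case True
    then have "x \<in> PIdl (x \<otimes> x)" using cgenideal_self xc by blast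
    then obtain r where r: "r \<in> carrier R" "x = r \<otimes> (x \<otimes> x)"
      using PIdl_mem_iff by blast
    let ?e = "r \<otimes> x" and ?f = "\<one> \<ominus> r \<otimes> x"
    have ec: "?e \<in> carrier R" "?f \<in> carrier R" using r xc by simp_all
    have ex: "?e \<otimes> x = x" using r xc by (simp add: m_assoc)
    have "?e \<otimes> ?e = r \<otimes> (?e \<otimes> x)" using r(1) xc by (simp add: m_assoc m_lcomm)
    then have ee: "?e \<otimes> ?e = ?e" using ex by simp
    have e0: "?e \<noteq> \<zero>" using ex x0 xc by auto
    have "?e \<otimes> ?f = ?e \<ominus> ?e \<otimes> ?e" using ec(1) by algebra
    then have ef: "?e \<otimes> ?f = \<zero>" using ee ec by (simp add: r_right_minus_eq)
    then have fe: "?f \<otimes> ?e = \<zero>" using m_comm ec by simp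
    have "?f \<otimes> ?f = ?f \<ominus> ?e \<otimes> ?f" using ec(1) by algebra
    then have ff: "?f \<otimes> ?f = ?f" using ef ec by (simp add: minus_eq)
    have sum: "?e \<oplus> ?f = \<one>" using ec(1) by algebra
    have ey: "?e \<otimes> y = \<zero>" using r(1) xc y by (simp add: m_assoc)
    have f0: "?f \<noteq> \<zero>"
    proof
      assume "?f = \<zero>"
      then have "?e = \<one>" using sum ec(1) by simp
      then have "\<one> \<otimes> y = \<zero>" using ey by simp
      then show False using y(1,2) by simp
    qed
    have "corner_field ?e"
      by (rule pairwise_annihilating_corner_field[OF pa ec(1) ee e0 ec(2) f0 ef])
    moreover have "corner_field ?f"
      by (rule pairwise_annihilating_corner_field[OF pa ec(2) ff f0 ec(1) e0 fe])
    ultimately have False using no_fields ef sum by blast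
    then show ?thesis ..
  qed
qed

text \<open>Two nonzero zero divisors either generate the same vertex, which then contains their sum, or
  annihilate each other; in that case a power of one of them annihilates the sum.\<close>

lemma pairwise_annihilating_zero_divisors_ideal:
  assumes pa: "pairwise_annihilating" and one: "\<one> \<noteq> \<zero>"
    and cube: "\<And>x. x \<in> zero_divisors R \<Longrightarrow> x \<otimes> x \<otimes> x = \<zero>"
  shows "ideal (zero_divisors R) R"
proof (rule zero_divisors_idealI[OF one])
  let ?Z = "zero_divisors R"
  have Zc: "x \<in> carrier R" if "x \<in> ?Z" for x using that by (simp add: zero_divisors_def)
  fix x y assume x: "x \<in> ?Z" and y: "y \<in> ?Z"
  show "x \<oplus> y \<in> ?Z"
  proof (cases "x = \<zero> \<or> y = \<zero>")
    case True
    then show ?thesis using x y Zc[OF x] Zc[OF y] by auto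
  next
    case False
    then have V: "PIdl x \<in> nonzero_annihilating_ideals R" "PIdl y \<in> nonzero_annihilating_ideals R"
      using PIdl_vertex x y by auto
    have self: "x \<in> PIdl x" "y \<in> PIdl y" using cgenideal_self Zc x y by auto
    show ?thesis
    proof (cases "PIdl x = PIdl y")
      case True
      then have "x \<oplus> y \<in> PIdl x"
        using ideal_add_mem[OF cgenideal_ideal[OF Zc[OF x]]] self by simp
      then show ?thesis using vertex_subset_zero_divisors[OF V(1)] by blast
    next
      case False
      then have xy: "x \<otimes> y = \<zero>"
        using pairwise_annihilatingD[OF pa V] self by blast
      \<comment> \<open>The last nonzero power of \<open>x\<close> annihilates both summands.\<close>
      define a where "a = (if x \<otimes> x = \<zero> then x else x \<otimes> x)"
      have "a \<in> carrier R" "a \<noteq> \<zero>"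
        using Zc[OF x] \<open>\<not> (x = \<zero> \<or> y = \<zero>)\<close> by (auto simp: a_def)
      moreover have "x \<otimes> a = \<zero>"
        using cube[OF x] Zc[OF x] by (auto simp: a_def m_assoc)
      moreover have "y \<otimes> x = \<zero>" using xy m_comm Zc x y by simp
      then have "y \<otimes> a = \<zero>"
        using m_assoc[of y x x] Zc[OF x] Zc[OF y] by (auto simp: a_def)
      ultimately show ?thesis
        using Zc[OF x] Zc[OF y] by (intro zero_divisorsI[of _ a]) (simp_all add: l_distr)
    qed
  qed
qed

text \<open>If the square of the ideal \<open>Z\<close> of zero divisors is not zero, completeness provides an \<open>x\<close> with
  \<open>x\<^sup>2 \<noteq> \<zero>\<close>. Any zero divisor not annihilated by \<open>x\<close> generates the same ideal as \<open>x\<close>. From this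
  one obtains first that \<open>Z\<close> is generated by \<open>x\<close>, then that regular elements are invertible, and
  finally that every nonzero proper ideal other than \<open>Z\<close> is generated by \<open>x\<^sup>2\<close>.\<close>

lemma pairwise_annihilating_two_ideals:
  assumes pa: "pairwise_annihilating"
    and cube: "\<And>x. x \<in> zero_divisors R \<Longrightarrow> x \<otimes> x \<otimes> x = \<zero>"
    and idZ: "ideal (zero_divisors R) R"
    and Z2: "(zero_divisors R) \<cdot> (zero_divisors R) \<noteq> {\<zero>}"
  shows "local_ring R"
    and "nonzero_proper_ideals R = {zero_divisors R, (zero_divisors R) \<cdot> (zero_divisors R)}"
    and "zero_divisors R \<noteq> (zero_divisors R) \<cdot> (zero_divisors R)"
proof -
  let ?Z = "zero_divisors R"
  have Zc: "x \<in> carrier R" if "x \<in> ?Z" for x using that by (simp add: zero_divisors_def)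
  have regular: "y = \<zero>" if "r \<in> carrier R" "r \<notin> ?Z" "y \<in> carrier R" "r \<otimes> y = \<zero>" for r y
    using that by (auto simp: zero_divisors_def)
  obtain x y where xy: "x \<in> ?Z" "y \<in> ?Z" "x \<otimes> y \<noteq> \<zero>"
    using Z2 ideal_prod_eq_zero_iff[OF idZ idZ] by blast
  have xc: "x \<in> carrier R" and yc: "y \<in> carrier R" using xy Zc by auto
  have x0: "x \<noteq> \<zero>" and y0: "y \<noteq> \<zero>" using xy(3) xc yc by auto
  have Vx: "PIdl x \<in> nonzero_annihilating_ideals R" using PIdl_vertex xy x0 by blast
  have same: "PIdl z = PIdl x" if "z \<in> ?Z" "z \<otimes> x \<noteq> \<zero>" for z
  proof (rule ccontr)
    assume "PIdl z \<noteq> PIdl x"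
    moreover have "z \<noteq> \<zero>" using that xc by auto
    ultimately have "z \<otimes> x = \<zero>"
      using pairwise_annihilatingD[OF pa PIdl_vertex[OF that(1)] Vx] cgenideal_self xc Zc[OF that(1)]
      by blast
    then show False using that(2) by blast
  qed
  \<comment> \<open>Since \<open>y\<close> is a multiple of \<open>x\<close>, the product \<open>x y\<close> would vanish together with \<open>x\<^sup>2\<close>.\<close>
  have xx: "x \<otimes> x \<noteq> \<zero>"
  proof
    assume 0: "x \<otimes> x = \<zero>"
    have "y \<otimes> x \<noteq> \<zero>" using xy(3) m_comm[OF xc yc] by simp
    then have "y \<in> PIdl x" using same[OF xy(2)] cgenideal_self[OF yc] by simp
    then show False using mult_PIdl_zero(1)[OF xc xc 0] xy(3) by blast
  qed
  have xxx: "x \<otimes> x \<otimes> x = \<zero>" by (rule cube[OF xy(1)])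
  have Z: "?Z = PIdl x"
  proof
    show "PIdl x \<subseteq> ?Z" by (rule cgenideal_minimal[OF idZ xy(1)])
    show "?Z \<subseteq> PIdl x"
    proof
      fix z assume z: "z \<in> ?Z"
      have zc: "z \<in> carrier R" by (rule Zc[OF z])
      show "z \<in> PIdl x"
      proof (cases "z \<otimes> x = \<zero>")
        case True
        \<comment> \<open>Here \<open>z + x\<close> is not annihilated by \<open>x\<close> and so lies in the ideal of \<open>x\<close>.\<close>
        then have "(z \<oplus> x) \<otimes> x \<noteq> \<zero>" using xx zc xc by (simp add: l_distr)
        then have "z \<oplus> x \<in> PIdl x"
          using same[OF ideal_add_mem[OF idZ z xy(1)]] cgenideal_self[of "z \<oplus> x"] zc xc by simp
        moreover have "\<ominus> x \<in> PIdl x"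
          using cgenideal_self[OF xc] cgenideal_ideal[OF xc]
          by (simp add: additive_subgroup.a_inv_closed ideal.axioms(1))
        ultimately have "(z \<oplus> x) \<oplus> \<ominus> x \<in> PIdl x"
          using ideal_add_mem[OF cgenideal_ideal[OF xc]] by blast
        moreover have "(z \<oplus> x) \<oplus> \<ominus> x = z" using zc xc by algebra
        ultimately show ?thesis by simp
      next
        case False
        then show ?thesis using same[OF z] cgenideal_self[OF zc] by simp
      qed
    qed
  qed
  have unit: "\<exists>v \<in> carrier R. v \<otimes> s = \<one>" if s: "s \<in> carrier R" "s \<notin> ?Z" for s
  proof -
    have sx: "s \<otimes> x \<in> ?Z" using ideal.I_l_closed[OF idZ xy(1) s(1)] .
    have "(s \<otimes> x) \<otimes> x \<noteq> \<zero>"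
      using regular[OF s, of "x \<otimes> x"] xx s(1) xc by (auto simp: m_assoc)
    then have "x \<in> PIdl (s \<otimes> x)" using same[OF sx] cgenideal_self[OF xc] by simp
    then obtain t where t: "t \<in> carrier R" "x = t \<otimes> (s \<otimes> x)" using PIdl_mem_iff by blast
    then have "x = (t \<otimes> s) \<otimes> x" using s(1) xc by (simp add: m_assoc)
    then have "\<one> \<ominus> t \<otimes> s \<in> ?Z" using one_minus_zero_divisor t(1) s(1) xc x0 by simp
    then obtain v where v: "v \<in> carrier R" "v \<otimes> (t \<otimes> s) = \<one>"
      using unit_if_nilpotent_difference[of "t \<otimes> s"] cube t(1) s(1) by auto
    then have "(v \<otimes> t) \<otimes> s = \<one>" using t(1) s(1) by (simp add: m_assoc)
    then show ?thesis using v(1) t(1) by blast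
  qed
  have sub: "J \<subseteq> ?Z" if J: "ideal J R" "J \<noteq> carrier R" for J
  proof
    fix r assume r: "r \<in> J"
    have rc: "r \<in> carrier R" using ideal_carrier_mem[OF J(1) r] .
    show "r \<in> ?Z"
    proof (rule ccontr)
      assume "r \<notin> ?Z"
      then obtain v where "v \<in> carrier R" "v \<otimes> r = \<one>" using unit rc by blast
      then have "\<one> \<in> J" using ideal.I_l_closed[OF J(1) r] by metis
      then show False using ideal.one_imp_carrier[OF J(1)] J(2) by blast
    qed
  qed
  have Znc: "?Z \<noteq> carrier R"
    using vertex_proper[OF Vx] Z one_closed by blast
  have max: "maximalideal ?Z R"
    using idZ Znc sub by (intro maximalidealI) auto
  moreover have "M = ?Z" if "maximalideal M R" for M
  proof -
    interpret M: maximalideal M R by fact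
    have "M \<subseteq> ?Z" using sub[OF M.is_ideal] M.I_notcarr by blast
    then show ?thesis using M.I_maximal[OF idZ] Znc Zc by blast
  qed
  ultimately show "local_ring R" unfolding local_ring_def by blast
  have kill: "a \<otimes> x = \<zero>" if "a \<in> ?Z \<cdot> ?Z" for a
    using that
  proof induct
    case (prod i j)
    then obtain r s where rs: "r \<in> carrier R" "s \<in> carrier R" "i = r \<otimes> x" "j = s \<otimes> x"
      using Z PIdl_mem_iff by auto
    have "(i \<otimes> j) \<otimes> x = (r \<otimes> s) \<otimes> (x \<otimes> x \<otimes> x)"
      unfolding rs using rs(1,2) xc by (simp add: m_assoc m_lcomm)
    then show ?case using rs(1,2) xxx by simp
  next
    case (sum a b)
    then have "a \<in> carrier R" "b \<in> carrier R"
      using ideal_carrier_mem[OF ideal_prod_is_ideal[OF idZ idZ]] by auto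
    then show ?case using sum xc by (simp add: l_distr)
  qed
  show ZZ: "?Z \<noteq> ?Z \<cdot> ?Z"
    using kill[of x] xx xy(1) by metis
  have idZZ: "ideal (?Z \<cdot> ?Z) R" by (rule ideal_prod_is_ideal[OF idZ idZ])
  have square: "J = PIdl (x \<otimes> x)" if J: "ideal J R" "J \<noteq> {\<zero>}" "J \<noteq> carrier R" "J \<noteq> ?Z" for J
  proof -
    have "z \<otimes> (x \<otimes> x) = \<zero>" if "z \<in> J" for z
      using mult_PIdl_zero(2)[of "x \<otimes> x" x z] sub[OF J(1,3)] that Z xc xxx by auto
    then have JV: "J \<in> nonzero_annihilating_ideals R"
      using J xx xc by (auto simp: vertex_iff)
    have form: "\<exists>s \<in> carrier R. j = s \<otimes> (x \<otimes> x)" if j: "j \<in> J" for j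
    proof -
      obtain r where r: "r \<in> carrier R" "j = r \<otimes> x"
        using j sub[OF J(1,3)] Z PIdl_mem_iff by blast
      have "j \<otimes> x = \<zero>"
        using pairwise_annihilatingD[OF pa JV Vx _ j cgenideal_self[OF xc]] J(4) Z by simp
      then have "r \<otimes> (x \<otimes> x) = \<zero>" using r xc by (simp add: m_assoc)
      then have "r \<in> ?Z" using regular[of r "x \<otimes> x"] r(1) xx xc by auto
      then obtain s where s: "s \<in> carrier R" "r = s \<otimes> x" using Z PIdl_mem_iff by blast
      then have "j = s \<otimes> (x \<otimes> x)" using r xc by (simp add: m_assoc)
      then show ?thesis using s(1) by blast
    qed
    obtain j where j: "j \<in> J" "j \<noteq> \<zero>" using ideal_nonzero_obtain[OF J(1,2)] .
    obtain s where s: "s \<in> carrier R" "j = s \<otimes> (x \<otimes> x)" using form[OF j(1)] by blast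
    have "s \<notin> ?Z"
    proof
      assume "s \<in> ?Z"
      then have "(x \<otimes> x) \<otimes> s = \<zero>"
        using mult_PIdl_zero(1)[of "x \<otimes> x" x s] Z xc xxx by auto
      then show False using j(2) s xc m_comm[of s "x \<otimes> x"] by simp
    qed
    then obtain v where v: "v \<in> carrier R" "v \<otimes> s = \<one>" using unit s(1) by blast
    have "v \<otimes> j = (v \<otimes> s) \<otimes> (x \<otimes> x)" using s v(1) xc by (simp add: m_assoc)
    then have "v \<otimes> j = x \<otimes> x" using v(2) xc by simp
    then have "x \<otimes> x \<in> J" using ideal.I_l_closed[OF J(1) j(1) v(1)] by simp
    then have "PIdl (x \<otimes> x) \<subseteq> J" by (rule cgenideal_minimal[OF J(1)])
    moreover have "J \<subseteq> PIdl (x \<otimes> x)" using form PIdl_mem_iff by blast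
    ultimately show ?thesis by blast
  qed
  have ZZnc: "?Z \<cdot> ?Z \<noteq> carrier R"
    using ideal_prod_inter[OF idZ idZ] Znc Zc by blast
  have "?Z \<cdot> ?Z = PIdl (x \<otimes> x)"
    by (rule square[OF idZZ Z2 ZZnc ZZ[symmetric]])
  then have "J \<in> {?Z, ?Z \<cdot> ?Z}" if "J \<in> nonzero_proper_ideals R" for J
    using that square[of J] by (cases "J = ?Z") (simp_all add: nonzero_proper_ideals_def)
  moreover have "?Z \<noteq> {\<zero>}" using xy(1) x0 by blast
  then have "?Z \<in> nonzero_proper_ideals R" "?Z \<cdot> ?Z \<in> nonzero_proper_ideals R"
    using idZ idZZ Znc ZZnc Z2 by (simp_all add: nonzero_proper_ideals_def)
  ultimately show "nonzero_proper_ideals R = {?Z, ?Z \<cdot> ?Z}"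
    by blast
qed

text \<open>What has to be excluded is \<open>Z\<^sup>3 \<noteq> \<zero>\<close>. Then \<open>Z\<^sup>3 = Z\<^sup>2\<close>, which is generated by some \<open>x\<close>, so
  \<open>x = z x\<close> with \<open>z \<in> Z\<close>; hence \<open>\<one> - z\<close> is a zero divisor and \<open>\<one> \<in> Z\<close>. This is Nakayama's
  lemma in miniature.\<close>

lemma two_ideals_pairwise_annihilating:
  assumes two: "nonzero_proper_ideals R = {zero_divisors R, (zero_divisors R) \<cdot> (zero_divisors R)}"
    and ne: "zero_divisors R \<noteq> (zero_divisors R) \<cdot> (zero_divisors R)"
  shows "pairwise_annihilating"
    and "nonzero_annihilating_ideals R = {zero_divisors R, (zero_divisors R) \<cdot> (zero_divisors R)}"
proof -
  let ?Z = "zero_divisors R"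
  let ?W = "?Z \<cdot> ?Z"
  have "?Z \<in> nonzero_proper_ideals R" "?W \<in> nonzero_proper_ideals R" using two by auto
  then have Z: "ideal ?Z R" "?Z \<noteq> {\<zero>}" "?Z \<noteq> carrier R" and W: "ideal ?W R" "?W \<noteq> {\<zero>}" "?W \<noteq> carrier R"
    by (auto simp: nonzero_proper_ideals_def)
  have WZ: "?W \<subseteq> ?Z" using ideal_prod_inter[OF Z(1) Z(1)] by blast
  have small: "J = ?W" if J: "ideal J R" "J \<noteq> {\<zero>}" "J \<subseteq> ?W" for J
  proof -
    have "J \<noteq> carrier R" using J(3) WZ Z ideal_carrier_mem[OF Z(1)] by blast
    then have "J \<in> nonzero_proper_ideals R" using J by (simp add: nonzero_proper_ideals_def)
    then show ?thesis using two J(3) WZ ne by blast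
  qed
  obtain x where x: "x \<in> ?W" "x \<noteq> \<zero>" using ideal_nonzero_obtain[OF W(1,2)] .
  have xc: "x \<in> carrier R" using ideal_carrier_mem[OF W(1) x(1)] .
  have Wx: "?W = PIdl x"
    using small[OF cgenideal_ideal[OF xc] PIdl_neq_zero[OF xc x(2)] cgenideal_minimal[OF W(1) x(1)]] by simp
  have ZW: "?Z \<cdot> ?W = {\<zero>}"
  proof (rule ccontr)
    assume nz: "?Z \<cdot> ?W \<noteq> {\<zero>}"
    have "?Z \<cdot> ?W = ?W"
      using small[OF ideal_prod_is_ideal[OF Z(1) W(1)] nz] ideal_prod_inter[OF Z(1) W(1)] by blast
    then have "x \<in> ?Z \<cdot> ?W" using x(1) by simp
    moreover have "\<exists>z \<in> ?Z. a = z \<otimes> x" if "a \<in> ?Z \<cdot> ?W" for a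
      using that
    proof induct
      case (prod i j)
      then obtain r where r: "r \<in> carrier R" "j = r \<otimes> x" using Wx PIdl_mem_iff by blast
      have ic: "i \<in> carrier R" using ideal_carrier_mem[OF Z(1) prod(1)] .
      have "i \<otimes> j = (i \<otimes> r) \<otimes> x" using r ic xc by (simp add: m_assoc)
      then show ?case using ideal.I_r_closed[OF Z(1) prod(1) r(1)] by blast
    next
      case (sum a b)
      then obtain z z' where z: "z \<in> ?Z" "a = z \<otimes> x" "z' \<in> ?Z" "b = z' \<otimes> x" by blast
      then have "a \<oplus> b = (z \<oplus> z') \<otimes> x"
        using ideal_carrier_mem[OF Z(1)] xc by (simp add: l_distr)
      then show ?case using ideal_add_mem[OF Z(1) z(1,3)] by blast
    qed
    ultimately obtain z where z: "z \<in> ?Z" "x = z \<otimes> x" by blast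
    have zc: "z \<in> carrier R" using ideal_carrier_mem[OF Z(1) z(1)] .
    have "\<one> \<ominus> z \<in> ?Z" by (rule one_minus_zero_divisor[OF zc xc x(2) z(2)])
    then have "(\<one> \<ominus> z) \<oplus> z \<in> ?Z" using ideal_add_mem[OF Z(1)] z(1) by blast
    moreover have "(\<one> \<ominus> z) \<oplus> z = \<one>" using zc by algebra
    ultimately show False using ideal.one_imp_carrier[OF Z(1)] Z(3) by simp
  qed
  have WZ0: "?W \<cdot> ?Z = {\<zero>}" using ZW ideal_prod_commute[OF Z(1) W(1)] by simp
  have "?Z \<in> nonzero_annihilating_ideals R" "?W \<in> nonzero_annihilating_ideals R"
    using vertex_if_product_zero[OF Z(1,2) W(1,2) ZW] vertex_if_product_zero[OF W(1,2) Z(1,2) WZ0]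
    by auto
  then show V: "nonzero_annihilating_ideals R = {?Z, ?W}"
    using vertices_subset_proper_ideals two by blast
  show "pairwise_annihilating"
    using ZW WZ0 unfolding pairwise_annihilating_def V by simp
qed

lemma complete_iff:
  assumes ne: "nonzero_annihilating_ideals R \<noteq> {}"
  shows "pairwise_annihilating \<and>
      \<not> (\<forall>I \<in> nonzero_annihilating_ideals R. \<forall>J \<in> nonzero_annihilating_ideals R. I = J) \<longleftrightarrow>
     (\<exists>e f. corner_field e \<and> corner_field f \<and> e \<otimes> f = \<zero> \<and> e \<oplus> f = \<one>)
      \<or> (ideal (zero_divisors R) R \<and> (zero_divisors R) \<cdot> (zero_divisors R) = {\<zero>}
           \<and> (\<exists>S \<subseteq> nonzero_annihilating_ideals R. card S = 2))
      \<or> (local_ring R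
           \<and> nonzero_proper_ideals R = {zero_divisors R, (zero_divisors R) \<cdot> (zero_divisors R)}
           \<and> zero_divisors R \<noteq> (zero_divisors R) \<cdot> (zero_divisors R))"
    (is "?lhs \<longleftrightarrow> ?a \<or> ?b \<or> ?c")
proof
  let ?Z = "zero_divisors R"
  assume lhs: ?lhs
  show "?a \<or> ?b \<or> ?c"
  proof (cases ?a)
    case False
    have pa: pairwise_annihilating using lhs by blast
    have cube: "x \<otimes> x \<otimes> x = \<zero>" if "x \<in> ?Z" for x
      by (rule pairwise_annihilating_cube_zero[OF pa that False])
    have idZ: "ideal ?Z R"
      by (rule pairwise_annihilating_zero_divisors_ideal[OF pa one_neq_zero_if_vertex[OF ne] cube])
    obtain I J where "I \<in> nonzero_annihilating_ideals R" "J \<in> nonzero_annihilating_ideals R" "I \<noteq> J"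
      using lhs by blast
    then have two: "\<exists>S \<subseteq> nonzero_annihilating_ideals R. card S = 2"
      by (intro exI[of _ "{I, J}"]) simp
    show ?thesis
    proof (cases "?Z \<cdot> ?Z = {\<zero>}")
      case True
      then show ?thesis using idZ two by blast
    next
      case False
      note pairwise_annihilating_two_ideals[OF pa cube idZ False]
      then show ?thesis by blast
    qed
  qed simp
next
  let ?Z = "zero_divisors R"
  assume "?a \<or> ?b \<or> ?c"
  then consider ?a | ?b | ?c by blast
  then show ?lhs
  proof cases
    case 1
    then obtain e f where ef: "corner_field e" "corner_field f" "e \<otimes> f = \<zero>" "e \<oplus> f = \<one>" by blast
    note V = corner_fields_vertices[OF ef]
    have "ideal (PIdl e) R" "ideal (PIdl f) R"
      using V(1) vertex_iff by blast+
    then have "(PIdl f) \<cdot> (PIdl e) = {\<zero>}" using V(3) ideal_prod_commute by metis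
    then show ?thesis using V(2,3) unfolding pairwise_annihilating_def V(1) by auto
  next
    case 2
    have "I \<cdot> J = {\<zero>}"
      if I: "I \<in> nonzero_annihilating_ideals R" and J: "J \<in> nonzero_annihilating_ideals R" for I J
    proof -
      have ids: "ideal I R" "ideal J R" using I J by (auto simp: vertex_iff)
      have idZ: "ideal ?Z R" and 0: "?Z \<cdot> ?Z = {\<zero>}" using 2 by auto
      have "\<forall>x \<in> ?Z. \<forall>y \<in> ?Z. x \<otimes> y = \<zero>" using ideal_prod_eq_zero_iff[OF idZ idZ] 0 by blast
      then show ?thesis
        using ideal_prod_eq_zero_iff[OF ids] vertex_subset_zero_divisors[OF I]
          vertex_subset_zero_divisors[OF J] by blast
    qed
    then have pairwise_annihilating by (simp add: pairwise_annihilating_def)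
    moreover obtain S where S: "S \<subseteq> nonzero_annihilating_ideals R" "card S = 2"
      using 2 by metis
    obtain I J where IJ: "S = {I, J}" "I \<noteq> J" using S(2) by (auto simp: card_2_iff)
    have "I \<in> nonzero_annihilating_ideals R" "J \<in> nonzero_annihilating_ideals R"
      using S(1) IJ(1) by simp_all
    then have "\<not> (\<forall>I \<in> nonzero_annihilating_ideals R. \<forall>J \<in> nonzero_annihilating_ideals R. I = J)"
      using IJ(2) by metis
    ultimately show ?thesis ..
  next
    case 3
    then have c: "nonzero_proper_ideals R = {?Z, ?Z \<cdot> ?Z}" "?Z \<noteq> ?Z \<cdot> ?Z" by simp_all
    have "\<not> (\<forall>I \<in> nonzero_annihilating_ideals R. \<forall>J \<in> nonzero_annihilating_ideals R. I = J)"
      unfolding two_ideals_pairwise_annihilating(2)[OF c] using c(2) by simp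
    then show ?thesis using two_ideals_pairwise_annihilating(1)[OF c] by simp
  qed
qed

text \<open>Of the three kinds of complete graphs in \<open>complete_iff\<close>, a product of two fields and a ring with
  exactly two nonzero proper ideals have at most two vertices.\<close>

lemma complete_three_vertices_square_zero:
  assumes ne: "nonzero_annihilating_ideals R \<noteq> {}" and pa: pairwise_annihilating
    and S: "S \<subseteq> nonzero_annihilating_ideals R" "card S = 3"
  shows "(zero_divisors R) \<cdot> (zero_divisors R) = {\<zero>}"
proof -
  have big: "nonzero_annihilating_ideals R \<noteq> {I, J}" for I J
  proof
    assume "nonzero_annihilating_ideals R = {I, J}"
    then have "card S \<le> card {I, J}" using S(1) by (intro card_mono) auto
    also have "\<dots> \<le> 2" by (simp add: card_insert_if)
    finally show False using S(2) by simp
  qed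
  have "\<not> (\<forall>I \<in> nonzero_annihilating_ideals R. \<forall>J \<in> nonzero_annihilating_ideals R. I = J)"
  proof
    assume all: "\<forall>I \<in> nonzero_annihilating_ideals R. \<forall>J \<in> nonzero_annihilating_ideals R. I = J"
    obtain I where "I \<in> nonzero_annihilating_ideals R" using ne by blast
    then have "nonzero_annihilating_ideals R = {I, I}" using all by blast
    then show False using big by blast
  qed
  with pa have "pairwise_annihilating \<and>
      \<not> (\<forall>I \<in> nonzero_annihilating_ideals R. \<forall>J \<in> nonzero_annihilating_ideals R. I = J)" ..
  then show ?thesis
    unfolding complete_iff[OF ne]
  proof (elim disjE exE conjE)
    fix e f assume "corner_field e" "corner_field f" "e \<otimes> f = \<zero>" "e \<oplus> f = \<one>"
    then show ?thesis using corner_fields_vertices(1) big by metis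
  next
    assume "nonzero_proper_ideals R = {zero_divisors R, (zero_divisors R) \<cdot> (zero_divisors R)}"
      "zero_divisors R \<noteq> (zero_divisors R) \<cdot> (zero_divisors R)"
    then show ?thesis using two_ideals_pairwise_annihilating(2) big by metis
  qed
qed

section \<open>Rings with nilpotent elements\<close>

text \<open>Vertices at distance three must have a nonzero product, besides a sum that is not annihilating.
  If \<open>I J = \<zero>\<close>, a nilpotent element repairs this: choose \<open>m = a n\<close> with \<open>a \<in> I\<close> and
  \<open>n\<^sup>2 = \<zero>\<close>, and enlarge \<open>J\<close> by the ideal of \<open>m\<close>. The enlarged ideal is annihilated by \<open>m\<close>,
  but not by \<open>I\<close>, since otherwise \<open>m\<close> would annihilate \<open>I + J\<close>.\<close>

lemma nonreduced_sum_not_annihilating: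
  assumes nr: "\<not> reduced_ring R" and I: "annihilating_ideal R I" and J: "annihilating_ideal R J"
    and na: "\<not> annihilating_ideal R (I <+>\<^bsub>R\<^esub> J)"
  shows "\<exists>I \<in> nonzero_annihilating_ideals R. \<exists>J \<in> nonzero_annihilating_ideals R.
    I \<noteq> J \<and> I \<cdot> J \<noteq> {\<zero>} \<and> \<not> annihilating_ideal R (I <+>\<^bsub>R\<^esub> J)"
proof -
  obtain n where n: "n \<in> carrier R" "n \<noteq> \<zero>" "n \<otimes> n = \<zero>"
    using nr by (auto simp: reduced_ring_iff_square)
  \<comment> \<open>The square-zero element \<open>n\<close> survives multiplication by one of the two ideals.\<close>
  have wlog: "\<exists>A \<in> nonzero_annihilating_ideals R. \<exists>B \<in> nonzero_annihilating_ideals R.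
      A \<noteq> B \<and> A \<cdot> B \<noteq> {\<zero>} \<and> \<not> annihilating_ideal R (A <+>\<^bsub>R\<^esub> B)"
    if I: "annihilating_ideal R I" and J: "annihilating_ideal R J"
      and na: "\<not> annihilating_ideal R (I <+>\<^bsub>R\<^esub> J)" and a: "a \<in> I" "a \<otimes> n \<noteq> \<zero>" for I J a
  proof -
    have ids: "ideal I R" "ideal J R" using I J by (auto simp: annihilating_ideal_def)
    have IJ0: "b = \<zero>" if "b \<in> carrier R" "\<forall>x \<in> I. x \<otimes> b = \<zero>" "\<forall>y \<in> J. y \<otimes> b = \<zero>" for b
      using na that annihilating_sum_iff[OF ids] by blast
    have ac: "a \<in> carrier R" using a(1) ideal_carrier_mem[OF ids(1)] by blast
    show ?thesis
    proof (cases "I \<cdot> J = {\<zero>}")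
      case False
      have "I \<noteq> J" using ideal_add_self[OF ids(1)] I na by auto
      moreover have "I \<noteq> {\<zero>}" "J \<noteq> {\<zero>}"
        using False ideal_prod_eq_zero_iff[OF ids] ideal_carrier_mem[OF ids(1)]
          ideal_carrier_mem[OF ids(2)] by auto
      ultimately show ?thesis
        using I J na False by (auto simp: nonzero_annihilating_ideals_def)
    next
      case True
      then have IJ: "x \<otimes> y = \<zero>" if "x \<in> I" "y \<in> J" for x y
        using ideal_prod_eq_zero_iff[OF ids] that by blast
      let ?m = "a \<otimes> n"
      let ?K = "J <+>\<^bsub>R\<^esub> PIdl ?m"
      have mc: "?m \<in> carrier R" using ac n by simp
      have mI: "?m \<in> I" using ideal.I_r_closed[OF ids(1) a(1) n(1)] .
      have "?m \<otimes> ?m = (a \<otimes> a) \<otimes> (n \<otimes> n)" using ac n(1) by (simp add: m_assoc m_lcomm)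
      then have mm: "?m \<otimes> ?m = \<zero>" using n(3) ac by simp
      have idP: "ideal (PIdl ?m) R" using cgenideal_ideal[OF mc] .
      have Jm: "y \<otimes> ?m = \<zero>" if "y \<in> J" for y
        using IJ[OF mI that] m_comm[OF mc] ideal_carrier_mem[OF ids(2) that] by simp
      have K: "annihilating_ideal R ?K"
        unfolding annihilating_sum_iff[OF ids(2) idP]
        using mc a(2) Jm mult_PIdl_zero(2)[OF mc mc mm] by blast
      have idK: "ideal ?K R" using K by (simp add: annihilating_ideal_def)
      have JK: "J \<subseteq> ?K" by (rule ideal_subset_sum(1)[OF ids(2) idP])
      have mK: "?m \<in> ?K" using ideal_subset_sum(2)[OF ids(2) idP] cgenideal_self[OF mc] by blast
      have IK: "\<not> annihilating_ideal R (I <+>\<^bsub>R\<^esub> ?K)"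
        unfolding annihilating_sum_iff[OF ids(1) idK] using IJ0 JK by blast
      have "I \<cdot> ?K \<noteq> {\<zero>}"
      proof
        assume "I \<cdot> ?K = {\<zero>}"
        then have "\<forall>x \<in> I. x \<otimes> ?m = \<zero>" using ideal_prod_eq_zero_iff[OF ids(1) idK] mK by blast
        then show False using IJ0[OF mc] Jm a(2) by blast
      qed
      moreover have "I \<noteq> ?K" using ideal_add_self[OF ids(1)] I IK by auto
      moreover have "I \<noteq> {\<zero>}" "?K \<noteq> {\<zero>}" using mI mK a(2) by auto
      ultimately show ?thesis
        using I K IK by (intro bexI[of _ I] bexI[of _ ?K]) (auto simp: nonzero_annihilating_ideals_def)
    qed
  qed
  have ids: "ideal I R" "ideal J R" using I J by (auto simp: annihilating_ideal_def)
  have "(\<exists>a \<in> I. a \<otimes> n \<noteq> \<zero>) \<or> (\<exists>a \<in> J. a \<otimes> n \<noteq> \<zero>)"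
    using na n annihilating_sum_iff[OF ids] by blast
  then show ?thesis
  proof
    assume "\<exists>a \<in> I. a \<otimes> n \<noteq> \<zero>"
    then show ?thesis using wlog[OF I J na] by blast
  next
    assume "\<exists>a \<in> J. a \<otimes> n \<noteq> \<zero>"
    moreover have "J <+>\<^bsub>R\<^esub> I = I <+>\<^bsub>R\<^esub> J" by (rule set_add_comm) (use ids ideal_carrier_mem in auto)
    ultimately show ?thesis using wlog[OF J I] na by auto
  qed
qed

text \<open>The sum of two zero divisors lies in the sum of their principal ideals.\<close>

lemma zero_divisors_ideal_if_sums_annihilating:
  assumes one: "\<one> \<noteq> \<zero>"
    and sums: "\<And>I J. annihilating_ideal R I \<Longrightarrow> annihilating_ideal R J \<Longrightarrow>
      annihilating_ideal R (I <+>\<^bsub>R\<^esub> J)"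
  shows "ideal (zero_divisors R) R"
proof (rule zero_divisors_idealI[OF one])
  fix x y assume xy: "x \<in> zero_divisors R" "y \<in> zero_divisors R"
  then have "x \<in> carrier R" "y \<in> carrier R" by (auto simp: zero_divisors_def)
  then have "x \<oplus> y \<in> PIdl x <+>\<^bsub>R\<^esub> PIdl y"
    using cgenideal_self unfolding set_add_def' by blast
  then show "x \<oplus> y \<in> zero_divisors R"
    using annihilating_subset_zero_divisors[OF sums] PIdl_annihilating xy by blast
qed

end

section \<open>The four values of the diameter\<close>

lemma enat_eq_iff_le_not_le:
  fixes d :: enat
  shows "d = 0 \<longleftrightarrow> d \<le> 0" and "d = 1 \<longleftrightarrow> d \<le> 1 \<and> \<not> d \<le> 0"
    and "d = 2 \<longleftrightarrow> d \<le> 2 \<and> \<not> d \<le> 1" and "d = 3 \<longleftrightarrow> d \<le> 3 \<and> \<not> d \<le> 2"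
  by (cases d; auto simp: numeral_eq_enat one_enat_def zero_enat_def)+

context cring
begin

lemma diam_le_1_iff_pairwise_annihilating:
  "graph_diam (annihilating_ideal_graph R) \<le> 1 \<longleftrightarrow> pairwise_annihilating"
  by (simp only: diam_le_1_iff pairwise_annihilating_def)

text \<open>The third vertex is the inner vertex of a path of length two.\<close>

lemma three_vertices_if_diam_2:
  assumes "graph_diam (annihilating_ideal_graph R) \<le> 2"
    and "\<not> graph_diam (annihilating_ideal_graph R) \<le> 1"
  shows "\<exists>S \<subseteq> nonzero_annihilating_ideals R. card S = 3"
proof -
  let ?G = "annihilating_ideal_graph R"
  obtain I J where I: "I \<in> nonzero_annihilating_ideals R" and J: "J \<in> nonzero_annihilating_ideals R"
    and "I \<noteq> J" and d: "\<not> graph_dist ?G I J \<le> 1"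
    using assms(2) unfolding graph_diam_le_iff verts_graph by metis
  have "graph_dist ?G I J \<le> 2"
    using assms(1) I J \<open>I \<noteq> J\<close> unfolding graph_diam_le_iff verts_graph by metis
  then obtain K where "I \<rightarrow>\<^bsub>?G\<^esub> K" "K \<rightarrow>\<^bsub>?G\<^esub> J"
    using d unfolding wf_digraph.graph_dist_le_1_iff[OF wf_graph \<open>I \<noteq> J\<close>]
      wf_digraph.graph_dist_le_2_iff[OF wf_graph \<open>I \<noteq> J\<close>] by metis
  then have "K \<in> nonzero_annihilating_ideals R" "I \<noteq> K" "K \<noteq> J"
    by (simp_all add: dominates_iff)
  then show ?thesis
    using I J \<open>I \<noteq> J\<close> by (intro exI[of _ "{I, K, J}"]) simp
qed

lemma reduced_diam:
  assumes red: "reduced_ring R" and fin: "finite (minimal_primes R)"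
    and ne: "nonzero_annihilating_ideals R \<noteq> {}"
  shows "graph_diam (annihilating_ideal_graph R) \<le> 2 \<longleftrightarrow> card (minimal_primes R) = 2"
    and "\<not> graph_diam (annihilating_ideal_graph R) \<le> 2 \<longleftrightarrow> card (minimal_primes R) > 2"
    and "card (minimal_primes R) = 2 \<Longrightarrow> S \<subseteq> nonzero_annihilating_ideals R \<Longrightarrow> card S = 3 \<Longrightarrow>
      \<not> graph_diam (annihilating_ideal_graph R) \<le> 1"
proof -
  have two: "card (minimal_primes R) \<ge> 2" by (rule reduced_at_least_two_minimal_primes[OF red fin ne])
  have many: "\<not> graph_diam (annihilating_ideal_graph R) \<le> 2" if "card (minimal_primes R) > 2"
    using reduced_many_minimal_primes[OF red fin that] unfolding diam_le_2_iff by metis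
  have few: "graph_diam (annihilating_ideal_graph R) \<le> 2" if card: "card (minimal_primes R) = 2"
  proof -
    obtain P Q where "minimal_primes R = {P, Q}" "P \<noteq> Q"
      using card by (auto simp: card_2_iff)
    then show ?thesis
      using reduced_two_minimal_primes_sum[OF red] unfolding diam_le_2_iff by metis
  qed
  show "graph_diam (annihilating_ideal_graph R) \<le> 2 \<longleftrightarrow> card (minimal_primes R) = 2"
    "\<not> graph_diam (annihilating_ideal_graph R) \<le> 2 \<longleftrightarrow> card (minimal_primes R) > 2"
    using two many few by linarith+
  assume card: "card (minimal_primes R) = 2"
    and S: "S \<subseteq> nonzero_annihilating_ideals R" "card S = 3"
  obtain P Q where "minimal_primes R = {P, Q}"
    using card by (auto simp: card_2_iff)
  then show "\<not> graph_diam (annihilating_ideal_graph R) \<le> 1"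
    using reduced_three_vertices[OF red _ S] S(1) unfolding diam_le_1_iff by (metis subsetD)
qed

lemma nonreduced_diam_le_2_iff:
  assumes nr: "\<not> reduced_ring R"
  shows "graph_diam (annihilating_ideal_graph R) \<le> 2 \<longleftrightarrow>
    (\<forall>I J. annihilating_ideal R I \<and> annihilating_ideal R J \<longrightarrow> annihilating_ideal R (I <+>\<^bsub>R\<^esub> J))"
proof
  assume d: "graph_diam (annihilating_ideal_graph R) \<le> 2"
  show "\<forall>I J. annihilating_ideal R I \<and> annihilating_ideal R J \<longrightarrow> annihilating_ideal R (I <+>\<^bsub>R\<^esub> J)"
    using nonreduced_sum_not_annihilating[OF nr] d unfolding diam_le_2_iff by metis
next
  assume "\<forall>I J. annihilating_ideal R I \<and> annihilating_ideal R J \<longrightarrow> annihilating_ideal R (I <+>\<^bsub>R\<^esub> J)"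
  then show "graph_diam (annihilating_ideal_graph R) \<le> 2"
    unfolding diam_le_2_iff by (simp add: nonzero_annihilating_ideals_def)
qed

lemma nonreduced_diam_eq_2_iff:
  assumes nr: "\<not> reduced_ring R" and ne: "nonzero_annihilating_ideals R \<noteq> {}"
  shows "graph_diam (annihilating_ideal_graph R) = 2 \<longleftrightarrow>
    ideal (zero_divisors R) R \<and> (zero_divisors R) \<cdot> (zero_divisors R) \<noteq> {\<zero>}
     \<and> (\<forall>I J. annihilating_ideal R I \<and> annihilating_ideal R J
          \<longrightarrow> annihilating_ideal R (I <+>\<^bsub>R\<^esub> J))
     \<and> (\<exists>S \<subseteq> nonzero_annihilating_ideals R. card S = 3)"
    (is "?d = 2 \<longleftrightarrow> ideal ?Z R \<and> ?sq \<and> ?sums \<and> ?three")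
proof
  assume "?d = 2"
  then have le2: "?d \<le> 2" and nle1: "\<not> ?d \<le> 1" unfolding enat_eq_iff_le_not_le(3) by auto
  have sums: ?sums using le2 unfolding nonreduced_diam_le_2_iff[OF nr] .
  have three: ?three by (rule three_vertices_if_diam_2[OF le2 nle1])
  have idZ: "ideal ?Z R"
    using zero_divisors_ideal_if_sums_annihilating[OF one_neq_zero_if_vertex[OF ne]] sums by metis
  have ?sq
  proof
    assume 0: "?Z \<cdot> ?Z = {\<zero>}"
    have "I \<cdot> J = {\<zero>}"
      if I: "I \<in> nonzero_annihilating_ideals R" and J: "J \<in> nonzero_annihilating_ideals R" for I J
    proof -
      have "ideal I R" "ideal J R" using I J by (auto simp: vertex_iff)
      then show ?thesis
        using ideal_prod_eq_zero_iff idZ 0 vertex_subset_zero_divisors[OF I]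
          vertex_subset_zero_divisors[OF J] by (metis subsetD)
    qed
    then show False using nle1 unfolding diam_le_1_iff by blast
  qed
  then show "ideal ?Z R \<and> ?sq \<and> ?sums \<and> ?three" using idZ sums three by metis
next
  assume rhs: "ideal ?Z R \<and> ?sq \<and> ?sums \<and> ?three"
  then have "?d \<le> 2" unfolding nonreduced_diam_le_2_iff[OF nr] by metis
  moreover have "\<not> ?d \<le> 1"
    unfolding diam_le_1_iff_pairwise_annihilating
    using complete_three_vertices_square_zero[OF ne] rhs by metis
  ultimately show "?d = 2" unfolding enat_eq_iff_le_not_le(3) ..
qed

end

theorem theorem1p9:
  fixes R :: "('a, 'b) ring_scheme" (structure)
  assumes "cring R"
    and "finite (minimal_primes R)"
    and "verts (annihilating_ideal_graph R) \<noteq> {}"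
  shows
    "(graph_diam (annihilating_ideal_graph R) = 0 \<longleftrightarrow>
        nonzero_proper_ideals R = {zero_divisors R}) \<and>
     (graph_diam (annihilating_ideal_graph R) = 1 \<longleftrightarrow>
        (\<exists>(F1 :: 'a ring) (F2 :: 'a ring). field F1 \<and> field F2 \<and> R \<simeq> RDirProd F1 F2)
      \<or> (ideal (zero_divisors R) R \<and> (zero_divisors R) \<cdot> (zero_divisors R) = {\<zero>}
           \<and> (\<exists>S \<subseteq> nonzero_annihilating_ideals R. card S = 2))
      \<or> (local_ring R
           \<and> nonzero_proper_ideals R = {zero_divisors R, (zero_divisors R) \<cdot> (zero_divisors R)}
           \<and> zero_divisors R \<noteq> (zero_divisors R) \<cdot> (zero_divisors R))) \<and>
     (graph_diam (annihilating_ideal_graph R) = 2 \<longleftrightarrow>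
        (reduced_ring R \<and> card (minimal_primes R) = 2
           \<and> (\<exists>S \<subseteq> nonzero_annihilating_ideals R. card S = 3))
      \<or> (\<not> reduced_ring R \<and> ideal (zero_divisors R) R
           \<and> (zero_divisors R) \<cdot> (zero_divisors R) \<noteq> {\<zero>}
           \<and> (\<forall>I J. annihilating_ideal R I \<and> annihilating_ideal R J
                \<longrightarrow> annihilating_ideal R (I <+> J))
           \<and> (\<exists>S \<subseteq> nonzero_annihilating_ideals R. card S = 3))) \<and>
     (graph_diam (annihilating_ideal_graph R) = 3 \<longleftrightarrow>
        (reduced_ring R \<and> card (minimal_primes R) > 2)
      \<or> (\<not> reduced_ring R
           \<and> (\<exists>I J. annihilating_ideal R I \<and> annihilating_ideal R J \<and> I \<noteq> J
                \<and> \<not> annihilating_ideal R (I <+> J))))"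
proof -
  interpret cring R by fact
  let ?d = "graph_diam (annihilating_ideal_graph R)"
  have ne: "nonzero_annihilating_ideals R \<noteq> {}" using assms(3) by simp
  have d0: "?d = 0 \<longleftrightarrow> nonzero_proper_ideals R = {zero_divisors R}"
    unfolding enat_eq_iff_le_not_le(1) diam_le_0_iff by (rule one_vertex_iff[OF ne])
  have d1: "?d = 1 \<longleftrightarrow>
      (\<exists>(F1 :: 'a ring) (F2 :: 'a ring). field F1 \<and> field F2 \<and> R \<simeq> RDirProd F1 F2)
      \<or> (ideal (zero_divisors R) R \<and> (zero_divisors R) \<cdot> (zero_divisors R) = {\<zero>}
           \<and> (\<exists>S \<subseteq> nonzero_annihilating_ideals R. card S = 2))
      \<or> (local_ring R
           \<and> nonzero_proper_ideals R = {zero_divisors R, (zero_divisors R) \<cdot> (zero_divisors R)}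
           \<and> zero_divisors R \<noteq> (zero_divisors R) \<cdot> (zero_divisors R))"
    unfolding enat_eq_iff_le_not_le(2) diam_le_0_iff diam_le_1_iff_pairwise_annihilating
      product_of_two_fields_iff
    by (rule complete_iff[OF ne])
  have d2: "?d = 2 \<longleftrightarrow>
        (reduced_ring R \<and> card (minimal_primes R) = 2
           \<and> (\<exists>S \<subseteq> nonzero_annihilating_ideals R. card S = 3))
      \<or> (\<not> reduced_ring R \<and> ideal (zero_divisors R) R
           \<and> (zero_divisors R) \<cdot> (zero_divisors R) \<noteq> {\<zero>}
           \<and> (\<forall>I J. annihilating_ideal R I \<and> annihilating_ideal R J
                \<longrightarrow> annihilating_ideal R (I <+>\<^bsub>R\<^esub> J))
           \<and> (\<exists>S \<subseteq> nonzero_annihilating_ideals R. card S = 3))"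
  proof (cases "reduced_ring R")
    case True
    note red = reduced_diam[OF True assms(2) ne]
    have "?d = 2 \<longleftrightarrow> card (minimal_primes R) = 2 \<and> (\<exists>S \<subseteq> nonzero_annihilating_ideals R. card S = 3)"
      using red(1,3) three_vertices_if_diam_2 unfolding enat_eq_iff_le_not_le(3) by metis
    then show ?thesis using True by (simp only: simp_thms)
  next
    case False
    then show ?thesis using nonreduced_diam_eq_2_iff[OF False ne] by (simp only: simp_thms)
  qed
  have d3: "?d = 3 \<longleftrightarrow>
        (reduced_ring R \<and> card (minimal_primes R) > 2)
      \<or> (\<not> reduced_ring R
           \<and> (\<exists>I J. annihilating_ideal R I \<and> annihilating_ideal R J \<and> I \<noteq> J
                \<and> \<not> annihilating_ideal R (I <+>\<^bsub>R\<^esub> J)))"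
  proof -
    have eq: "?d = 3 \<longleftrightarrow> \<not> ?d \<le> 2"
      unfolding enat_eq_iff_le_not_le(4) using diam_le_3 by (simp only: simp_thms)
    show ?thesis
    proof (cases "reduced_ring R")
      case True
      then show ?thesis
        unfolding eq using reduced_diam(2)[OF True assms(2) ne] by (simp only: simp_thms)
    next
      case False
      have self: "I \<noteq> J" if "annihilating_ideal R I" "\<not> annihilating_ideal R (I <+>\<^bsub>R\<^esub> J)" for I J
        using that ideal_add_self unfolding annihilating_ideal_def by metis
      show ?thesis
        unfolding eq nonreduced_diam_le_2_iff[OF False] using False self by metis
    qed
  qed
  show ?thesis
    by (intro conjI d0 d1 d2 d3)
qed

end
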